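(* Let $K$ be an $(\mathbb{F}_q,\mathbb{Z})$-field and let $X\subseteq K^{k+r}$ be $\mathcal{L}_{\mathrm{aff}}^K$-definable. Let $\pi_k:K^{k+r}\to K^k$ be the projection onto the first $k$ coordinates. Then there exists an $\mathcal{L}_{\mathrm{aff}}^K$-definable function $g:\pi_k(X)\to X$ with $\pi_k\circ g=\mathrm{Id}_{\pi_k(X)}$.
   Context: An $(\mathbb{F}_q,\mathbb{Z})$-field is a valued field $K$ (valuation $\mathrm{ord}$, $\mathrm{ord}\,0=\infty$, valuation ring $R_K$; not necessarily Henselian, any characteristic) whose residue field is isomorphic to $\mathbb{F}_q$ and whose value group is elementarily equivalent to $\mathbb{Z}$. Fix $\pi\in K$ of smallest positive order, $\mathrm{ord}\,\pi=1$. For $m\ge1$, $\mathrm{ac}_{\pi^m}:K^\times\to(R_K/\pi^mR_K)^\times$ is the unique group homomorphism with $\mathrm{ac}_{\pi^m}(\pi)=1$ and $\mathrm{ac}_{\pi^m}(u)\equiv u\bmod\pi^m$ for units $u$. For $n,m\ge1$, $\Lambda_{n,m}$ is the quotient of $K$ by: $x\sim y$ iff $x=y=0$, or $x,y\ne0$, $\mathrm{ord}\,x\equiv\mathrm{ord}\,y\bmod n$ and $\mathrm{ac}_{\pi^m}(x)=\mathrm{ac}_{\pi^m}(y)$; $\rho_{n,m}:K\to\Lambda_{n,m}$ is the quotient map. The one-sorted language $\mathcal{L}_{\mathrm{aff}}^K$ consists of $+,-$, scalar multiplications $\bar c:x\mapsto cx$ for all $c\in K$, the relation $x\mid y\iff\mathrm{ord}\,x\le\mathrm{ord}\,y$,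 and ternary relations $R_{n,m}(x,y,z)\iff\rho_{n,m}(y-x)=\rho_{n,m}(z)$ ($n,m\ge1$); parameters from $K$ are allowed. *)

theory Defs
  imports Main
begin

fun natmul :: "nat \<Rightarrow> 'g::ab_group_add \<Rightarrow> 'g" where
  "natmul 0 g = 0"
| "natmul (Suc n) g = g + natmul n g"

datatype gterm = GVar nat | GZero | GAdd gterm gterm | GNeg gterm

datatype gform = GEq gterm gterm | GLess gterm gterm | GFalse | GNot gform
  | GAnd gform gform | GEx nat gform

fun geval :: "(nat \<Rightarrow> 'g::linordered_ab_group_add) \<Rightarrow> gterm \<Rightarrow> 'g" where
  "geval e (GVar i) = e i"
| "geval e GZero = 0"
| "geval e (GAdd s t) = geval e s + geval e t"
| "geval e (GNeg t) = - geval e t"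

fun gsat :: "(nat \<Rightarrow> 'g::linordered_ab_group_add) \<Rightarrow> gform \<Rightarrow> bool" where
  "gsat e (GEq s t) = (geval e s = geval e t)"
| "gsat e (GLess s t) = (geval e s < geval e t)"
| "gsat e GFalse = False"
| "gsat e (GNot f) = (\<not> gsat e f)"
| "gsat e (GAnd f g) = (gsat e f \<and> gsat e g)"
| "gsat e (GEx i f) = (\<exists>a. gsat (e(i := a)) f)"

fun gtvars :: "gterm \<Rightarrow> nat set" where
  "gtvars (GVar i) = {i}"
| "gtvars GZero = {}"
| "gtvars (GAdd s t) = gtvars s \<union> gtvars t"
| "gtvars (GNeg t) = gtvars t"

fun gfv :: "gform \<Rightarrow> nat set" where
  "gfv (GEq s t) = gtvars s \<union> gtvars t"
| "gfv (GLess s t) = gtvars s \<union> gtvars t"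
| "gfv GFalse = {}"
| "gfv (GNot f) = gfv f"
| "gfv (GAnd f g) = gfv f \<union> gfv g"
| "gfv (GEx i f) = gfv f - {i}"

text \<open>Elementary equivalence with (Z,+,-,0,<): same sentences hold
  (truth of a sentence does not depend on the assignment; we use the constant one).\<close>
definition elem_equiv_Z :: "'g::linordered_ab_group_add itself \<Rightarrow> bool" where
  "elem_equiv_Z TYPE('g) \<longleftrightarrow>
     (\<forall>\<phi>. gfv \<phi> = {} \<longrightarrow> (gsat (\<lambda>_. 0::'g) \<phi> \<longleftrightarrow> gsat (\<lambda>_. 0::int) \<phi>))"

text \<open>A valued field: @ord@ is given on nonzero elements with values in the
  ordered group 'g, onto 'g (so 'g is the value group); ord 0 = infinity is
  handled explicitly below.\<close>
definition valuation :: "('a::field \<Rightarrow> 'g::linordered_ab_group_add) \<Rightarrow> bool" where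
  "valuation v \<longleftrightarrow>
     (\<forall>x y. x \<noteq> 0 \<longrightarrow> y \<noteq> 0 \<longrightarrow> v (x * y) = v x + v y)
   \<and> (\<forall>x y. x \<noteq> 0 \<longrightarrow> y \<noteq> 0 \<longrightarrow> x + y \<noteq> 0 \<longrightarrow> min (v x) (v y) \<le> v (x + y))
   \<and> (\<forall>\<gamma>. \<exists>x. x \<noteq> 0 \<and> v x = \<gamma>)"

definition val_ring :: "('a::field \<Rightarrow> 'g::linordered_ab_group_add) \<Rightarrow> 'a set" where
  "val_ring v = {x. x = 0 \<or> 0 \<le> v x}"

definition max_ideal :: "('a::field \<Rightarrow> 'g::linordered_ab_group_add) \<Rightarrow> 'a set" where
  "max_ideal v = {x. x = 0 \<or> 0 < v x}"

definition residue_field :: "('a::field \<Rightarrow> 'g::linordered_ab_group_add) \<Rightarrow> 'a set set" where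
  "residue_field v = (\<lambda>x. {y \<in> val_ring v. x - y \<in> max_ideal v}) ` val_ring v"

definition FqZ_field :: "nat \<Rightarrow> ('a::field \<Rightarrow> 'g::linordered_ab_group_add) \<Rightarrow> bool" where
  "FqZ_field q v \<longleftrightarrow> valuation v
     \<and> finite (residue_field v) \<and> card (residue_field v) = q
     \<and> elem_equiv_Z TYPE('g)"

definition uniformizer :: "('a::field \<Rightarrow> 'g::linordered_ab_group_add) \<Rightarrow> 'a \<Rightarrow> bool" where
  "uniformizer v p \<longleftrightarrow> p \<noteq> 0 \<and> 0 < v p \<and> (\<forall>x. x \<noteq> 0 \<longrightarrow> 0 < v x \<longrightarrow> v p \<le> v x)"

text \<open>The coset u + pi^m R_K (an element of R_K / pi^m R_K).\<close>
definition mcoset :: "('a::field \<Rightarrow> 'g::linordered_ab_group_add) \<Rightarrow> 'a \<Rightarrow> nat \<Rightarrow> 'a \<Rightarrow> 'a set" where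
  "mcoset v p m u = {u + z | z. z = 0 \<or> natmul m (v p) \<le> v z}"

definition is_unit :: "('a::field \<Rightarrow> 'g::linordered_ab_group_add) \<Rightarrow> 'a \<Rightarrow> bool" where
  "is_unit v u \<longleftrightarrow> u \<noteq> 0 \<and> v u = 0"

text \<open>f is a group homomorphism K^x \<rightarrow> (R_K/pi^m R_K)^x with f(pi) = 1 and
  f(u) = u mod pi^m for units u (f 0 is fixed to the empty set as a dummy value).\<close>
definition is_ac :: "('a::field \<Rightarrow> 'g::linordered_ab_group_add) \<Rightarrow> 'a \<Rightarrow> nat \<Rightarrow> ('a \<Rightarrow> 'a set) \<Rightarrow> bool" where
  "is_ac v p m f \<longleftrightarrow>
     f 0 = {}
   \<and> (\<forall>x. x \<noteq> 0 \<longrightarrow> (\<exists>u. is_unit v u \<and> f x = mcoset v p m u))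
   \<and> (\<forall>x y a b. x \<noteq> 0 \<longrightarrow> y \<noteq> 0 \<longrightarrow> f x = mcoset v p m a \<longrightarrow> f y = mcoset v p m b
          \<longrightarrow> f (x * y) = mcoset v p m (a * b))
   \<and> f p = mcoset v p m 1
   \<and> (\<forall>u. is_unit v u \<longrightarrow> f u = mcoset v p m u)"

definition ac :: "('a::field \<Rightarrow> 'g::linordered_ab_group_add) \<Rightarrow> 'a \<Rightarrow> nat \<Rightarrow> 'a \<Rightarrow> 'a set" where
  "ac v p m = (THE f. is_ac v p m f)"

definition rho_eq :: "('a::field \<Rightarrow> 'g::linordered_ab_group_add) \<Rightarrow> 'a \<Rightarrow> nat \<Rightarrow> nat \<Rightarrow> 'a \<Rightarrow> 'a \<Rightarrow> bool" where
  "rho_eq v p n m x y \<longleftrightarrow>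
     (x = 0 \<and> y = 0)
   \<or> (x \<noteq> 0 \<and> y \<noteq> 0 \<and> (\<exists>\<gamma>. v x - v y = natmul n \<gamma>) \<and> ac v p m x = ac v p m y)"

datatype 'a aterm = AVar nat | AConst 'a | AAdd "'a aterm" "'a aterm" | ASub "'a aterm" "'a aterm"
  | ANeg "'a aterm" | AScal 'a "'a aterm"

datatype 'a aform = AEq "'a aterm" "'a aterm" | ADiv "'a aterm" "'a aterm"
  | AR nat nat "'a aterm" "'a aterm" "'a aterm"
  | AFalse | ANot "'a aform" | AAnd "'a aform" "'a aform" | AEx nat "'a aform"

fun aeval :: "(nat \<Rightarrow> 'a::field) \<Rightarrow> 'a aterm \<Rightarrow> 'a" where
  "aeval e (AVar i) = e i"
| "aeval e (AConst c) = c"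
| "aeval e (AAdd s t) = aeval e s + aeval e t"
| "aeval e (ASub s t) = aeval e s - aeval e t"
| "aeval e (ANeg t) = - aeval e t"
| "aeval e (AScal c t) = c * aeval e t"

text \<open>x | y iff ord x \<le> ord y (with ord 0 = infinity).\<close>
definition vdvd :: "('a::field \<Rightarrow> 'g::linordered_ab_group_add) \<Rightarrow> 'a \<Rightarrow> 'a \<Rightarrow> bool" where
  "vdvd v x y \<longleftrightarrow> y = 0 \<or> (x \<noteq> 0 \<and> v x \<le> v y)"

fun asat :: "('a::field \<Rightarrow> 'g::linordered_ab_group_add) \<Rightarrow> 'a \<Rightarrow> (nat \<Rightarrow> 'a) \<Rightarrow> 'a aform \<Rightarrow> bool" where
  "asat v p e (AEq s t) = (aeval e s = aeval e t)"
| "asat v p e (ADiv s t) = vdvd v (aeval e s) (aeval e t)"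
| "asat v p e (AR n m s t u) = rho_eq v p n m (aeval e t - aeval e s) (aeval e u)"
| "asat v p e AFalse = False"
| "asat v p e (ANot f) = (\<not> asat v p e f)"
| "asat v p e (AAnd f g) = (asat v p e f \<and> asat v p e g)"
| "asat v p e (AEx i f) = (\<exists>a. asat v p (e(i := a)) f)"

fun awf :: "'a aform \<Rightarrow> bool" where
  "awf (AR n m s t u) = (1 \<le> n \<and> 1 \<le> m)"
| "awf (ANot f) = awf f"
| "awf (AAnd f g) = (awf f \<and> awf g)"
| "awf (AEx i f) = awf f"
| "awf _ = True"

fun atvars :: "'a aterm \<Rightarrow> nat set" where
  "atvars (AVar i) = {i}"
| "atvars (AConst c) = {}"
| "atvars (AAdd s t) = atvars s \<union> atvars t"
| "atvars (ASub s t) = atvars s \<union> atvars t"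
| "atvars (ANeg t) = atvars t"
| "atvars (AScal c t) = atvars t"

fun afv :: "'a aform \<Rightarrow> nat set" where
  "afv (AEq s t) = atvars s \<union> atvars t"
| "afv (ADiv s t) = atvars s \<union> atvars t"
| "afv (AR n m s t u) = atvars s \<union> atvars t \<union> atvars u"
| "afv AFalse = {}"
| "afv (ANot f) = afv f"
| "afv (AAnd f g) = afv f \<union> afv g"
| "afv (AEx i f) = afv f - {i}"

definition aff_definable :: "('a::field \<Rightarrow> 'g::linordered_ab_group_add) \<Rightarrow> 'a \<Rightarrow> nat \<Rightarrow> 'a list set \<Rightarrow> bool" where
  "aff_definable v p N X \<longleftrightarrow>
     (\<exists>\<phi>. awf \<phi> \<and> afv \<phi> \<subseteq> {..<N} \<and> X = {xs. length xs = N \<and> asat v p (\<lambda>i. xs ! i) \<phi>})"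

definition aff_definable_fun :: "('a::field \<Rightarrow> 'g::linordered_ab_group_add) \<Rightarrow> 'a \<Rightarrow> nat \<Rightarrow> nat
    \<Rightarrow> 'a list set \<Rightarrow> ('a list \<Rightarrow> 'a list) \<Rightarrow> bool" where
  "aff_definable_fun v p N M A g \<longleftrightarrow>
     (\<forall>x\<in>A. length (g x) = M) \<and> aff_definable v p (N + M) {x @ g x | x. x \<in> A}"

end

(*
  Virtual substitution.  Up to the relation rho_{n,m}, every nonzero element of K equals one of
  finitely many constants of standard order; and among elements of bounded standard order finitely
  many constants suffice up to factors in 1 + pi^m R.  For affine forms a_j t + b_j in a variable t,
  let c_i be the root nearest to t.  Either t - c_i is, up to a factor in 1 + pi^m R, a constant
  multiple of one of the scales d in {1, (a_j c_i + b_j) / a_k}, or its order is far from all of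
  them and t - c_i may be moved next to a neighbouring scale without changing its class.  So
  finitely many test terms c_i + w d realise every quantifier-free type in t.  This gives quantifier
  elimination and piecewise affine Skolem functions simultaneously.
*)
theory Submission
  imports Defs
begin

section \<open>Ordered groups elementarily equivalent to the integers\<close>

text \<open>The value group may be nonarchimedean, so x need not be a power of pi times a unit, and
  \<open>ac\<close> cannot be read off such a factorisation. The substitute is x = y^N pi^i u with i
  < N. Elementary equivalence with the integers supplies division with remainder of ord x by N;
  finiteness of the residue field supplies an N with u^N = 1 modulo pi^m for all units u, so that
  y^N is invisible to \<open>ac\<close>. This factorisation yields existence and uniqueness of
  \<open>ac\<close> and the finiteness of the set of classes. A second obstacle is uniformity: the
  scales vary with the remaining variables, whereas finitely many terms must serve all their values.
  Hence the multipliers w are chosen from n and m alone, before any scale is known. The test terms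
  stay in the language because c_i and d arise from affine terms by division by coefficients, that
  is, by constants of K.\<close>

lemma natmul_add_left: "natmul (m + n) g = natmul m g + natmul n g"
  by (induction m) (auto simp: add.assoc)

lemma natmul_add: "natmul n (a + b) = natmul n a + natmul n b"
  by (induction n) (auto simp: algebra_simps)

lemma natmul_zero [simp]: "natmul n 0 = 0"
  by (induction n) auto

lemma natmul_uminus: "natmul n (- a) = - natmul n a"
  by (induction n) auto

lemma natmul_diff: "natmul n (a - b) = natmul n a - natmul n b"
  using natmul_add[of n a "- b"] by (simp add: natmul_uminus)

lemma natmul_mult: "natmul (m * n) g = natmul m (natmul n g)"
  by (induction m) (auto simp: natmul_add_left)

lemma natmul_nonneg: "0 \<le> g \<Longrightarrow> 0 \<le> natmul n (g::'g::linordered_ab_group_add)"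
  by (induction n) auto

lemma natmul_mono:
  fixes g :: "'g::linordered_ab_group_add"
  assumes "0 \<le> g" "m \<le> n"
  shows "natmul m g \<le> natmul n g"
proof -
  obtain k where "n = m + k" using assms(2) le_Suc_ex by blast
  then show ?thesis using natmul_nonneg[OF assms(1), of k] by (simp add: natmul_add_left)
qed

lemma natmul_strict_mono:
  fixes g :: "'g::linordered_ab_group_add"
  assumes "0 < g" "m < n"
  shows "natmul m g < natmul n g"
proof -
  have "natmul m g < natmul (Suc m) g" using assms(1) by simp
  also have "\<dots> \<le> natmul n g" using assms by (intro natmul_mono) auto
  finally show ?thesis .
qed

lemma natmul_inject:
  fixes g :: "'g::linordered_ab_group_add"
  assumes "0 < g" "natmul m g = natmul n g"
  shows "m = n"
  using natmul_strict_mono[OF assms(1)] assms(2) by (metis less_irrefl nat_neq_iff)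

lemma natmul_int: "natmul n (z::int) = int n * z"
  by (induction n) (auto simp: algebra_simps)

text \<open>A nonzero \<open>g\<close> in the range is at least \<open>one\<close>, so
  \<open>one\<close> can be subtracted, fewer than \<open>n\<close> times in all. This is the way
  back from order bounds to standard integers.\<close>

lemma natmul_least_positive:
  fixes g one :: "'g::linordered_ab_group_add"
  assumes one: "0 < one" "\<And>x. 0 < x \<Longrightarrow> one \<le> x"
    and g: "0 \<le> g" "g < natmul n one"
  shows "\<exists>i<n. g = natmul i one"
  using g
proof (induction n arbitrary: g)
  case (Suc n)
  show ?case
  proof (cases "g = 0")
    case False
    then have "one \<le> g" using one(2)[of g] Suc.prems(1) by auto
    then have "0 \<le> g - one" "g - one < natmul n one"
      using Suc.prems(2) by (auto simp: algebra_simps)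
    then obtain i where "i < n" "g - one = natmul i one" using Suc.IH by blast
    then show ?thesis by (intro exI[of _ "Suc i"]) (auto simp: algebra_simps)
  qed (auto intro!: exI[of _ 0])
qed auto

section \<open>Division with remainder as a first-order sentence\<close>

fun gmul :: "nat \<Rightarrow> gterm \<Rightarrow> gterm" where
  "gmul 0 t = GZero"
| "gmul (Suc n) t = GAdd t (gmul n t)"

lemma geval_gmul [simp]: "geval e (gmul n t) = natmul n (geval e t)"
  by (induction n) auto

lemma gtvars_gmul: "gtvars (gmul n t) \<subseteq> gtvars t"
  by (induction n) auto

text \<open>Variable 0 stands for the least positive element, for which the language has no
  constant; 1 is the dividend (and, before that, a competitor in the minimality clause), 2 the
  quotient, 3 the remainder. The remainder is confined by inequalities only;
  \<open>natmul_least_positive\<close> turns it into a multiple of \<open>one\<close>.\<close>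

definition gdivision :: "nat \<Rightarrow> gform" where
  "gdivision n = GNot (GEx 0 (GAnd (GAnd (GLess GZero (GVar 0))
       (GNot (GEx 1 (GAnd (GLess GZero (GVar 1)) (GLess (GVar 1) (GVar 0))))))
     (GEx 1 (GNot (GEx 2 (GEx 3 (GAnd (GEq (GVar 1) (GAdd (gmul n (GVar 2)) (GVar 3)))
       (GAnd (GNot (GLess (GVar 3) GZero)) (GLess (GVar 3) (gmul n (GVar 0)))))))))))"

lemma gsat_gdivision:
  fixes e :: "nat \<Rightarrow> 'g::linordered_ab_group_add"
  shows "gsat e (gdivision n) \<longleftrightarrow>
     (\<forall>one::'g. 0 < one \<longrightarrow> (\<forall>x>0. one \<le> x) \<longrightarrow>
       (\<forall>x. \<exists>y z. x = natmul n y + z \<and> 0 \<le> z \<and> z < natmul n one))"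
  by (simp add: gdivision_def not_less[symmetric]) blast

lemma gdivision_int:
  assumes "1 \<le> n"
  shows "gsat (\<lambda>_. 0::int) (gdivision n)"
  unfolding gsat_gdivision
proof (intro allI impI)
  fix one x :: int
  assume one: "0 < one" "\<forall>x>0. one \<le> x"
  then have "one = 1" by (metis antisym int_one_le_iff_zero_less zero_less_one)
  then show "\<exists>y z. x = natmul n y + z \<and> 0 \<le> z \<and> z < natmul n one"
    using assms by (intro exI[of _ "x div int n"] exI[of _ "x mod int n"]) (auto simp: natmul_int)
qed

lemma elem_equiv_Z_division:
  fixes one x :: "'g::linordered_ab_group_add"
  assumes "elem_equiv_Z TYPE('g)" "0 < one" "\<And>x. 0 < x \<Longrightarrow> one \<le> x" "1 \<le> n"
  shows "\<exists>y i. i < n \<and> x = natmul n y + natmul i one"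
proof -
  have "gfv (gdivision n) = {}"
    using gtvars_gmul[of n "GVar 0"] gtvars_gmul[of n "GVar 2"] by (auto simp: gdivision_def)
  then have "gsat (\<lambda>_. 0::'g) (gdivision n)"
    using assms(1) gdivision_int[OF assms(4)] unfolding elem_equiv_Z_def by blast
  then obtain y z where yz: "x = natmul n y + z" "0 \<le> z" "z < natmul n one"
    using assms(2,3) unfolding gsat_gdivision by blast
  then show ?thesis using natmul_least_positive[OF assms(2,3) yz(2,3)] by blast
qed

section \<open>Valued fields\<close>

locale FqZ_valued_field =
  fixes v :: "'a::field \<Rightarrow> 'g::linordered_ab_group_add" and p :: 'a and q :: nat
  assumes FqZ: "FqZ_field q v" and unif: "uniformizer v p"
begin

lemma val: "valuation v"
  using FqZ by (auto simp: FqZ_field_def)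

lemma v_mult: "x \<noteq> 0 \<Longrightarrow> y \<noteq> 0 \<Longrightarrow> v (x * y) = v x + v y"
  using val by (auto simp: valuation_def)

lemma v_add_ge: "x \<noteq> 0 \<Longrightarrow> y \<noteq> 0 \<Longrightarrow> x + y \<noteq> 0 \<Longrightarrow> min (v x) (v y) \<le> v (x + y)"
  using val by (auto simp: valuation_def)

lemma v_surj: "\<exists>x. x \<noteq> 0 \<and> v x = g"
  using val by (auto simp: valuation_def)

lemma v_one [simp]: "v 1 = 0"
  using v_mult[of 1 1] by simp

lemma v_uminus [simp]: "v (- x) = v x"
proof (cases "x = 0")
  case False
  have "v (- 1) + v (- 1) = 0" using v_mult[of "-1" "-1"] by simp
  then have "v (- 1) = 0" by (simp add: double_zero)
  then show ?thesis using v_mult[of "-1" x] False by simp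
qed simp

lemma v_inverse: "x \<noteq> 0 \<Longrightarrow> v (inverse x) = - v x"
  using v_mult[of x "inverse x"] by (simp add: minus_unique)

lemma v_divide: "x \<noteq> 0 \<Longrightarrow> y \<noteq> 0 \<Longrightarrow> v (x / y) = v x - v y"
  by (simp add: divide_inverse v_mult v_inverse)

lemma v_power: "x \<noteq> 0 \<Longrightarrow> v (x ^ n) = natmul n (v x)"
  by (induction n) (auto simp: v_mult)

lemma v_add_eq:
  assumes "x \<noteq> 0" "y = 0 \<or> v x < v y"
  shows "x + y \<noteq> 0" "v (x + y) = v x"
proof -
  show *: "x + y \<noteq> 0"
    using assms v_uminus[of y] by (auto simp: add_eq_0_iff2)
  show "v (x + y) = v x"
  proof (cases "y = 0")
    case False
    then have "min (v (x + y)) (v (- y)) \<le> v (x + y + - y)"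
      using * assms by (intro v_add_ge) auto
    moreover have "min (v x) (v y) \<le> v (x + y)" using False * assms by (intro v_add_ge) auto
    ultimately show ?thesis using assms False by (auto simp: min_def split: if_splits)
  qed simp
qed

lemma p_nonzero [simp]: "p \<noteq> 0"
  using unif by (auto simp: uniformizer_def)

lemma v_p_pos: "0 < v p"
  using unif by (auto simp: uniformizer_def)

lemma natmul_v_p_mono: "m \<le> n \<Longrightarrow> natmul m (v p) \<le> natmul n (v p)"
  using natmul_mono less_imp_le[OF v_p_pos] by blast

lemma v_p_least: "0 < g \<Longrightarrow> v p \<le> g"
  using unif v_surj[of g] by (auto simp: uniformizer_def)

lemma v_division: "1 \<le> n \<Longrightarrow> \<exists>y i. i < n \<and> g = natmul n y + natmul i (v p)"
  using FqZ v_p_pos v_p_least by (intro elem_equiv_Z_division) (auto simp: FqZ_field_def)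

lemma v_eq_natmul: "0 \<le> g \<Longrightarrow> g < natmul n (v p) \<Longrightarrow> \<exists>i<n. g = natmul i (v p)"
  using v_p_pos v_p_least by (intro natmul_least_positive) auto

subsection \<open>Powers of the maximal ideal\<close>

definition I :: "nat \<Rightarrow> 'a set" where
  "I m = {z. z = 0 \<or> natmul m (v p) \<le> v z}"

lemma I_zero [simp]: "0 \<in> I m"
  by (simp add: I_def)

lemma I_uminus [simp]: "- x \<in> I m \<longleftrightarrow> x \<in> I m"
  by (simp add: I_def)

lemma I_add: "x \<in> I m \<Longrightarrow> y \<in> I m \<Longrightarrow> x + y \<in> I m"
  using v_add_ge[of x y]
  by (cases "x = 0 \<or> y = 0 \<or> x + y = 0") (auto simp: I_def min_le_iff_disj intro: order_trans)

lemma I_diff: "x \<in> I m \<Longrightarrow> y \<in> I m \<Longrightarrow> x - y \<in> I m"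
  using I_add[of x m "- y"] by simp

lemma I_mult: "x \<in> I m \<Longrightarrow> y \<in> I n \<Longrightarrow> x * y \<in> I (m + n)"
  by (cases "x = 0 \<or> y = 0") (auto simp: I_def v_mult natmul_add_left add_mono)

lemma I_mono: "m \<le> n \<Longrightarrow> I n \<subseteq> I m"
  using natmul_mono[of "v p" m n] v_p_pos by (auto simp: I_def less_imp_le intro: order_trans)

lemma I_0: "I 0 = val_ring v"
  by (auto simp: I_def val_ring_def)

lemma I_absorb: "x \<in> I m \<Longrightarrow> y \<in> I 0 \<Longrightarrow> x * y \<in> I m"
  using I_mult[of x m y 0] by simp

lemma p_power_in_I: "p ^ m \<in> I m"
  by (simp add: I_def v_power)

lemma I_Suc_0: "I (Suc 0) = max_ideal v"
  using v_p_least v_p_pos by (auto simp: I_def max_ideal_def)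

lemma unit_in_I0: "is_unit v u \<Longrightarrow> u \<in> I 0"
  by (simp add: I_def is_unit_def)

lemma one_in_I0 [simp]: "1 \<in> I 0"
  by (simp add: I_def)

lemma unit_mult: "is_unit v u \<Longrightarrow> is_unit v w \<Longrightarrow> is_unit v (u * w)"
  by (auto simp: is_unit_def v_mult)

lemma unit_inverse: "is_unit v u \<Longrightarrow> is_unit v (inverse u)"
  by (auto simp: is_unit_def v_inverse)

lemma unit_one [simp]: "is_unit v 1"
  by (auto simp: is_unit_def)

lemma unit_power: "is_unit v u \<Longrightarrow> is_unit v (u ^ n)"
  by (induction n) (auto intro: unit_mult)

lemma unit_add: 
  assumes "is_unit v u" "z \<in> I m" "1 \<le> m"
  shows "is_unit v (u + z)"
proof -
  have "z \<in> max_ideal v" using assms I_mono[of "Suc 0" m] I_Suc_0 by auto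
  then show ?thesis using v_add_eq[of u z] assms(1) by (auto simp: is_unit_def max_ideal_def)
qed

lemma mcoset_I: "mcoset v p m u = {u + z | z. z \<in> I m}"
  by (auto simp: mcoset_def I_def)

lemma mcoset_eq_iff: "mcoset v p m u = mcoset v p m w \<longleftrightarrow> u - w \<in> I m"
proof
  assume "mcoset v p m u = mcoset v p m w"
  moreover have "u \<in> mcoset v p m u" by (auto simp: mcoset_I intro!: exI[of _ 0])
  ultimately show "u - w \<in> I m" by (auto simp: mcoset_I)
next
  have *: "mcoset v p m u \<subseteq> mcoset v p m w" if uw: "u - w \<in> I m" for u w
  proof
    fix x assume "x \<in> mcoset v p m u"
    then obtain z where "z \<in> I m" "x = u + z" by (auto simp: mcoset_I)
    then show "x \<in> mcoset v p m w"
      using I_add[OF uw] by (auto simp: mcoset_I intro!: exI[of _ "u - w + z"])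
  qed
  assume "u - w \<in> I m"
  moreover have "w - u \<in> I m" using I_uminus[of "u - w"] calculation by simp
  ultimately show "mcoset v p m u = mcoset v p m w" using * by blast
qed

lemma I_mult_cong:
  assumes "a - b \<in> I m" "c - d \<in> I m" "a \<in> I 0" "d \<in> I 0"
  shows "a * c - b * d \<in> I m"
proof -
  have "a * c - b * d = (c - d) * a + (a - b) * d" by (simp add: algebra_simps)
  then show ?thesis using assms by (auto intro!: I_add I_absorb)
qed

lemma I_power_cong:
  assumes "a - b \<in> I m" "a \<in> I 0" "b \<in> I 0"
  shows "a ^ n - b ^ n \<in> I m"
proof -
  have "x ^ n \<in> I 0" if "x \<in> I 0" for x n
    by (induction n) (auto intro: I_absorb that)
  then show ?thesis using assms by (induction n) (auto intro!: I_mult_cong)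
qed

text \<open>Digit expansion: a representative modulo pi^m is refined by \<open>p ^ m\<close> times a
  representative of a residue class.\<close>

lemma finite_residues: "\<exists>F. finite F \<and> F \<subseteq> I 0 \<and> (\<forall>x\<in>I 0. \<exists>f\<in>F. x - f \<in> I m)"
proof (induction m)
  case 0
  show ?case by (intro exI[of _ "{0}"]) (auto intro: I_diff)
next
  case (Suc m)
  then obtain F where F: "finite F" "F \<subseteq> I 0" "\<And>x. x \<in> I 0 \<Longrightarrow> \<exists>f\<in>F. x - f \<in> I m"
    by blast
  define cls where "cls x = {y \<in> val_ring v. x - y \<in> max_ideal v}" for x
  have "finite (cls ` I 0)"
    using FqZ by (simp add: FqZ_field_def residue_field_def cls_def[abs_def] I_0)
  then obtain G where G: "G \<subseteq> I 0" "finite G" "cls ` G = cls ` I 0"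
    by (metis finite_subset_image subset_refl)
  have G2: "\<exists>g\<in>G. y - g \<in> I (Suc 0)" if y: "y \<in> I 0" for y
  proof -
    obtain g where g: "g \<in> G" "cls g = cls y" using G y by (metis imageE imageI)
    have "y \<in> cls y" using y by (auto simp: cls_def I_0 max_ideal_def)
    then have "y \<in> cls g" using g(2) by simp
    then have "g - y \<in> I (Suc 0)" by (simp add: cls_def I_Suc_0)
    then have "y - g \<in> I (Suc 0)" using I_uminus[of "g - y"] by simp
    then show ?thesis using g(1) by blast
  qed
  let ?F = "(\<lambda>(f, g). f + p ^ m * g) ` (F \<times> G)"
  have "\<exists>f\<in>?F. x - f \<in> I (Suc m)" if x: "x \<in> I 0" for x
  proof -
    obtain f where f: "f \<in> F" "x - f \<in> I m" using F x by blast
    \<comment> \<open>The error \<open>x - f\<close> is divisible by \<open>p ^ m\<close>, and the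
      residue of the quotient is the next digit.\<close>
    have "(x - f) / p ^ m \<in> I 0"
      using f(2) by (cases "x = f") (auto simp: I_def v_divide v_power)
    then obtain g where g: "g \<in> G" "(x - f) / p ^ m - g \<in> I (Suc 0)" using G2 by blast
    have "x - (f + p ^ m * g) = p ^ m * ((x - f) / p ^ m - g)" by (simp add: field_simps)
    also have "\<dots> \<in> I (m + Suc 0)" using g(2) p_power_in_I by (intro I_mult)
    finally show ?thesis using f g by force
  qed
  moreover have "?F \<subseteq> I 0"
    using F G p_power_in_I[of m] I_mono[of 0 m] by (auto intro!: I_add I_absorb)
  ultimately show ?case using F G by (intro exI[of _ ?F]) auto
qed

subsection \<open>Angular components\<close>

text \<open>Such an \<open>N\<close> is a positive multiple of the exponent of the unit group of R_K
  / pi^m R_K.\<close>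

definition kills :: "nat \<Rightarrow> nat \<Rightarrow> bool" where
  "kills N m \<longleftrightarrow> 1 \<le> N \<and> (\<forall>u. is_unit v u \<longrightarrow> u ^ N - 1 \<in> I m)"

lemma kills_mono: "kills N m \<Longrightarrow> m' \<le> m \<Longrightarrow> kills N m'"
  using I_mono by (fastforce simp: kills_def)

text \<open>Pigeonhole on the powers of \<open>u\<close>, whose classes modulo pi^m are represented
  by a finite set.\<close>

lemma ex_kills: "\<exists>N. kills N m"
proof -
  obtain F where F: "finite F" "F \<subseteq> I 0" "\<And>x. x \<in> I 0 \<Longrightarrow> \<exists>f\<in>F. x - f \<in> I m"
    using finite_residues by meson
  \<comment> \<open>The factorial of \<open>card F\<close>: the period \<open>j - i\<close> found
    below depends on \<open>u\<close> but is at most \<open>card F\<close>, so it always divides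
    \<open>N\<close>.\<close>
  define N where "N = (\<Prod>i\<in>{1..card F}. i)"
  have "u ^ N - 1 \<in> I m" if u: "is_unit v u" for u
  proof -
    obtain r where r: "\<And>x. x \<in> I 0 \<Longrightarrow> r x \<in> F \<and> x - r x \<in> I m" using F(3) by metis
    have ui: "u ^ i \<in> I 0" for i using u unit_power unit_in_I0 by blast
    have "card ((\<lambda>i. r (u ^ i)) ` {0..card F}) \<le> card F"
      using r ui by (intro card_mono F) auto
    then have "\<not> inj_on (\<lambda>i. r (u ^ i)) {0..card F}"
      using card_image[of "\<lambda>i. r (u ^ i)" "{0..card F}"] by auto
    then obtain i j where ij: "i < j" "j \<le> card F" "r (u ^ i) = r (u ^ j)"
      unfolding inj_on_def by (metis atLeastAtMost_iff linorder_neqE_nat)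
    have "(u ^ j - r (u ^ j)) - (u ^ i - r (u ^ i)) \<in> I m"
      using r ui by (intro I_diff[of "u ^ j - r (u ^ j)"]) auto
    then have "u ^ j - u ^ i \<in> I m" using ij by simp
    then have "(u ^ j - u ^ i) * inverse (u ^ i) \<in> I m"
      using u by (intro I_absorb unit_in_I0 unit_inverse unit_power)
    moreover have "(u ^ j - u ^ i) * inverse (u ^ i) = u ^ (j - i) - 1"
      using u ij by (auto simp: field_simps is_unit_def power_diff)
    ultimately have 1: "u ^ (j - i) - 1 \<in> I m" by simp
    have "(j - i) dvd N" unfolding N_def using ij by (intro dvd_prodI) auto
    then obtain l where l: "N = (j - i) * l" by blast
    have "(u ^ (j - i)) ^ l - 1 ^ l \<in> I m" using 1 ui by (intro I_power_cong) auto
    then show ?thesis by (simp add: l power_mult)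
  qed
  moreover have "1 \<le> N" unfolding N_def by (simp add: Suc_leI prod_pos)
  ultimately show ?thesis unfolding kills_def by blast
qed

text \<open>Replaces x = pi^(ord x) u, which makes no sense if ord x is not a standard multiple of
  ord pi. The quotient of ord x by \<open>N\<close> is realised as the order of some
  \<open>y\<close>, and only the standard remainder is left to \<open>p\<close>.\<close>

lemma decompose:
  assumes "1 \<le> N" "x \<noteq> 0"
  obtains y i u where "y \<noteq> 0" "i < N" "is_unit v u" "x = y ^ N * p ^ i * u"
proof -
  obtain g i where gi: "i < N" "v x = natmul N g + natmul i (v p)"
    using v_division[OF assms(1)] by blast
  obtain y where y: "y \<noteq> 0" "v y = g" using v_surj by blast
  have "is_unit v (x / (y ^ N * p ^ i))"
    using assms y gi by (auto simp: is_unit_def v_divide v_mult v_power)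
  then show ?thesis using y gi by (intro that[of y i "x / (y ^ N * p ^ i)"]) auto
qed

text \<open>Comparing orders shows that \<open>y\<close> and \<open>y'\<close> differ in order by a
  standard multiple \<open>l\<close> of \<open>v p\<close>. Then \<open>w = y * p ^ l / y'\<close>
  is a unit, the two decompositions differ by \<open>w ^ N\<close>, and \<open>N\<close> kills
  \<open>w\<close>.\<close>

lemma decompose_unique_aux:
  assumes N: "kills N m" and y: "y \<noteq> 0" "y' \<noteq> 0" and u: "is_unit v u" "is_unit v u'"
    and eq: "y ^ N * p ^ i * u = y' ^ N * p ^ j * u'" and ji: "j \<le> i"
  shows "u - u' \<in> I m"
proof -
  have u0: "u \<noteq> 0" "u' \<noteq> 0" "v u = 0" "v u' = 0" using u by (auto simp: is_unit_def)
  let ?g = "v y' - v y"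
  have N1: "1 \<le> N" using N by (simp add: kills_def)
  have "natmul N (v y) + natmul i (v p) = natmul N (v y') + natmul j (v p)"
    using arg_cong[OF eq, of v] y u0 by (simp add: v_mult v_power)
  then have eqv: "natmul (i - j) (v p) = natmul N ?g"
    using ji natmul_add_left[of "i - j" j "v p"] by (simp add: natmul_diff algebra_simps)
  have g0: "0 \<le> ?g"
  proof (rule ccontr)
    assume "\<not> 0 \<le> ?g"
    then have "0 < - ?g" by simp
    then have "natmul 0 (- ?g) < natmul N (- ?g)" using N1 by (intro natmul_strict_mono) auto
    then show False
      using eqv natmul_nonneg[of "v p" "i - j"] less_imp_le[OF v_p_pos] natmul_uminus[of N ?g] by auto
  qed
  \<comment> \<open>As \<open>?g\<close> is nonnegative and \<open>N\<close> positive,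
    \<open>?g\<close> is bounded by a standard multiple of \<open>v p\<close>, hence is one itself
    and can be absorbed into a power of \<open>p\<close>.\<close>
  have "?g \<le> natmul N ?g" using natmul_mono[OF g0 N1] by simp
  also have "\<dots> < natmul (Suc (i - j)) (v p)"
    using eqv natmul_strict_mono[OF v_p_pos, of "i - j" "Suc (i - j)"] by simp
  finally obtain l where l: "?g = natmul l (v p)" using v_eq_natmul[OF g0] by blast
  then have "natmul (i - j) (v p) = natmul (N * l) (v p)" using eqv by (simp add: natmul_mult)
  then have "i - j = N * l" using natmul_inject v_p_pos by blast
  then have i: "i = j + N * l" using ji by simp
  define w where "w = y * p ^ l / y'"
  have w: "is_unit v w"
    using y l[symmetric] by (auto simp: w_def is_unit_def v_divide v_mult v_power)
  have "y ^ N * p ^ i = (y * p ^ l) ^ N * p ^ j"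
    by (simp add: i power_add power_mult_distrib power_mult[symmetric] mult_ac)
  then have "w ^ N * u = u'"
    using eq y by (simp add: w_def power_divide field_simps)
  then have "u' - u = (w ^ N - 1) * u" by (simp add: algebra_simps)
  also have "\<dots> \<in> I m" using N w u unit_in_I0 by (intro I_absorb) (auto simp: kills_def)
  finally show ?thesis using I_uminus[of "u' - u"] by simp
qed

lemma decompose_unique:
  assumes "kills N m" "y \<noteq> 0" "y' \<noteq> 0" "is_unit v u" "is_unit v u'"
    "y ^ N * p ^ i * u = y' ^ N * p ^ j * u'"
  shows "u - u' \<in> I m"
proof (cases "j \<le> i")
  case True
  then show ?thesis using decompose_unique_aux assms by blast
next
  case False
  then have "u' - u \<in> I m" using decompose_unique_aux[of N m y' y u' u j i] assms by simp
  then show ?thesis using I_uminus[of "u' - u"] by simp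
qed

lemma is_ac_ex: "is_ac v p m f \<Longrightarrow> x \<noteq> 0 \<Longrightarrow> \<exists>u. is_unit v u \<and> f x = mcoset v p m u"
  unfolding is_ac_def by blast

lemma is_ac_mult:
  "is_ac v p m f \<Longrightarrow> x \<noteq> 0 \<Longrightarrow> y \<noteq> 0 \<Longrightarrow> f x = mcoset v p m a \<Longrightarrow> f y = mcoset v p m b
    \<Longrightarrow> f (x * y) = mcoset v p m (a * b)"
  unfolding is_ac_def by blast

lemma is_ac_unit: "is_ac v p m f \<Longrightarrow> is_unit v u \<Longrightarrow> f u = mcoset v p m u"
  unfolding is_ac_def by blast

lemma is_ac_p: "is_ac v p m f \<Longrightarrow> f p = mcoset v p m 1"
  unfolding is_ac_def by blast

lemma is_ac_power:
  assumes f: "is_ac v p m f" and x: "x \<noteq> 0" "is_unit v u" "f x = mcoset v p m u"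
  shows "f (x ^ n) = mcoset v p m (u ^ n)"
proof (induction n)
  case 0
  show ?case using is_ac_unit[OF f unit_one] by simp
next
  case (Suc n)
  then show ?case using is_ac_mult[OF f x(1) _ x(3), of "x ^ n" "u ^ n"] x(1) by simp
qed

text \<open>Values of \<open>f\<close> are classes of units, so \<open>f\<close> is trivial on N-th
  powers, and it is trivial on powers of \<open>p\<close> by normalisation. This is the uniqueness
  half of \<open>is_ac_ac\<close>.\<close>

lemma is_ac_decomposed:
  assumes f: "is_ac v p m f" and N: "kills N m" and y: "y \<noteq> 0" and u: "is_unit v u"
  shows "f (y ^ N * p ^ i * u) = mcoset v p m u"
proof -
  obtain w where w: "is_unit v w" "f y = mcoset v p m w" using is_ac_ex[OF f y] by blast
  have "w ^ N - 1 \<in> I m" using N w(1) unfolding kills_def by blast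
  then have "f (y ^ N) = mcoset v p m 1"
    using is_ac_power[OF f y w] mcoset_eq_iff by simp
  moreover have "f (p ^ i) = mcoset v p m 1"
    using is_ac_power[OF f p_nonzero unit_one is_ac_p[OF f]] by simp
  ultimately have "f (y ^ N * p ^ i) = mcoset v p m 1"
    using is_ac_mult[OF f, of "y ^ N" "p ^ i" 1 1] y by simp
  then show ?thesis
    using is_ac_mult[OF f, of "y ^ N * p ^ i" u 1 u] is_ac_unit[OF f u] y u
    by (simp add: is_unit_def)
qed

text \<open>Justifies the definite description in \<open>ac\<close>: by
  \<open>decompose_unique\<close> the class of \<open>u\<close> in \<open>y ^ N * p ^ i * u\<close>
  is well defined, and \<open>is_ac_decomposed\<close> leaves no other choice.\<close>

lemma is_ac_ac:
  assumes m: "1 \<le> m"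
  shows "is_ac v p m (ac v p m)"
proof -
  obtain N where N: "kills N m" using ex_kills by blast
  then have N1: "1 \<le> N" by (simp add: kills_def)
  \<comment> \<open>A union of cosets over all decompositions of \<open>x\<close>; zero has none,
    which produces the dummy value \<open>{}\<close>.\<close>
  define f where "f x = {w. \<exists>y i u. y \<noteq> 0 \<and> is_unit v u \<and> x = y ^ N * p ^ i * u \<and> w \<in> mcoset v p m u}" for x
  have fdec: "f (y ^ N * p ^ i * u) = mcoset v p m u" if "y \<noteq> 0" "is_unit v u" for y i u
  proof -
    have "mcoset v p m u' = mcoset v p m u"
      if "y' \<noteq> 0" "is_unit v u'" "y ^ N * p ^ i * u = y' ^ N * p ^ j * u'" for y' j u'
      using decompose_unique[OF N, of y y' u u' i j] that \<open>y \<noteq> 0\<close> \<open>is_unit v u\<close> mcoset_eq_iff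
      by metis
    then show ?thesis using that unfolding f_def by blast
  qed
  have "is_ac v p m f"
    unfolding is_ac_def
  proof (intro conjI allI impI)
    show "f 0 = {}" by (auto simp: f_def is_unit_def)
    show "\<exists>u. is_unit v u \<and> f x = mcoset v p m u" if "x \<noteq> 0" for x
      using decompose[OF N1 that] fdec by metis
    show "f p = mcoset v p m 1" using fdec[of 1 1 1] by simp
    show "f u = mcoset v p m u" if "is_unit v u" for u using fdec[of 1 u 0] that by simp
  next
    fix x y a b
    assume xy: "x \<noteq> 0" "y \<noteq> 0" and ab: "f x = mcoset v p m a" "f y = mcoset v p m b"
    obtain x' i u where x: "x' \<noteq> 0" "is_unit v u" "x = x' ^ N * p ^ i * u"
      using decompose[OF N1 xy(1)] by metis
    obtain y' j w where y: "y' \<noteq> 0" "is_unit v w" "y = y' ^ N * p ^ j * w"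
      using decompose[OF N1 xy(2)] by metis
    have "x * y = (x' * y') ^ N * p ^ (i + j) * (u * w)"
      by (simp add: x y power_mult_distrib power_add mult_ac)
    then have "f (x * y) = mcoset v p m (u * w)"
      using fdec[of "x' * y'" "u * w" "i + j"] x(1,2) y(1,2) unit_mult by simp
    moreover have "u - a \<in> I m" "w - b \<in> I m" using fdec x y ab mcoset_eq_iff by metis+
    \<comment> \<open>Multiplicativity in \<open>is_ac\<close> ranges over arbitrary representatives
      \<open>a\<close>, \<open>b\<close>; integrality of \<open>b\<close> is inherited from the unit
      \<open>w\<close> in the same coset.\<close>
    moreover have "b \<in> I 0"
      using \<open>w - b \<in> I m\<close> I_mono[of 0 m] y(2) unit_in_I0 I_diff[of w 0 "w - b"] by auto
    ultimately show "f (x * y) = mcoset v p m (a * b)"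
      using x(2) mcoset_eq_iff by (auto intro!: I_mult_cong unit_in_I0)
  qed
  moreover have "g = f" if g: "is_ac v p m g" for g
  proof
    fix x
    show "g x = f x"
    proof (cases "x = 0")
      case True
      then show ?thesis using g calculation by (simp add: is_ac_def)
    next
      case False
      then show ?thesis
        using decompose[OF N1 False] is_ac_decomposed[OF g N] is_ac_decomposed[OF calculation N]
        by metis
    qed
  qed
  ultimately show ?thesis unfolding ac_def by (metis theI)
qed

lemmas ac_decomposed = is_ac_decomposed[OF is_ac_ac]

lemma ac_mult_cong:
  assumes m: "1 \<le> m" and nz: "x \<noteq> 0" "y \<noteq> 0" "c \<noteq> 0" and eq: "ac v p m x = ac v p m y"
  shows "ac v p m (c * x) = ac v p m (c * y)"
proof -
  note f = is_ac_ac[OF m]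
  obtain a where a: "ac v p m x = mcoset v p m a" using is_ac_ex[OF f nz(1)] by blast
  obtain b where b: "ac v p m c = mcoset v p m b" using is_ac_ex[OF f nz(3)] by blast
  show ?thesis using is_ac_mult[OF f nz(3,1) b a] is_ac_mult[OF f nz(3,2) b] a eq by simp
qed

subsection \<open>The equivalence relations given by congruent orders and equal angular components\<close>

lemma rho_refl [simp]: "rho_eq v p n m x x"
  by (auto simp: rho_eq_def intro!: exI[of _ 0])

lemma rho_sym: "rho_eq v p n m x y \<Longrightarrow> rho_eq v p n m y x"
  unfolding rho_eq_def by (metis minus_diff_eq natmul_uminus)

lemma rho_trans: "rho_eq v p n m x y \<Longrightarrow> rho_eq v p n m y z \<Longrightarrow> rho_eq v p n m x z"
  unfolding rho_eq_def by (metis diff_add_cancel add_diff_eq natmul_add)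

lemma rho_zero_iff: "rho_eq v p n m x y \<Longrightarrow> x = 0 \<longleftrightarrow> y = 0"
  by (auto simp: rho_eq_def)

lemma rho_scale:
  assumes "1 \<le> m" "rho_eq v p n m x y"
  shows "rho_eq v p n m (c * x) (c * y)"
proof (cases "c = 0 \<or> x = 0 \<or> y = 0")
  case True
  then show ?thesis using assms by (auto simp: rho_eq_def)
next
  case False
  then show ?thesis using assms ac_mult_cong[of m x y c] by (simp add: rho_eq_def v_mult)
qed

lemma one_plus_I:
  assumes "z \<in> I m" "1 \<le> m"
  shows "1 + z \<noteq> 0" "v (1 + z) = 0"
  using unit_add[of 1 z m] assms by (auto simp: is_unit_def)

text \<open>The factor \<open>1 + z\<close> is a unit congruent to 1, so it lies in the kernel of
  both the order and the angular component; scaling by \<open>x\<close> gives the rest.\<close>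

lemma rho_near:
  assumes m: "1 \<le> m" and z: "z \<in> I m"
  shows "rho_eq v p n m x (x * (1 + z))"
proof -
  have u: "is_unit v (1 + z)" using unit_add[of 1 z m] assms by auto
  have "ac v p m (1 + z) = mcoset v p m (1 + z)" "ac v p m 1 = mcoset v p m 1"
    using is_ac_unit[OF is_ac_ac[OF m]] u by auto
  then have "ac v p m 1 = ac v p m (1 + z)" using z mcoset_eq_iff by auto
  then have "rho_eq v p n m 1 (1 + z)"
    using u by (auto simp: rho_eq_def is_unit_def intro!: exI[of _ 0])
  then show ?thesis using rho_scale[OF m, of n 1 "1 + z" x] by simp
qed

text \<open>An exponent killing units modulo pi^m also kills them modulo the lower power, so one
  decomposition computes both angular components. This lets a single pair \<open>n\<close>,
  \<open>m\<close> serve all relations of a formula.\<close>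

lemma rho_coarsen:
  assumes m: "1 \<le> m'" "m' \<le> m" and n: "n' dvd n" and xy: "rho_eq v p n m x y"
  shows "rho_eq v p n' m' x y"
proof (cases "x = 0 \<or> y = 0")
  case True
  then show ?thesis using xy by (auto simp: rho_eq_def)
next
  case False
  obtain g where g: "v x - v y = natmul n g" "ac v p m x = ac v p m y"
    using xy False by (auto simp: rho_eq_def)
  obtain l where l: "n = n' * l" using n by blast
  obtain N where N: "kills N m" using ex_kills by blast
  then have N1: "1 \<le> N" by (simp add: kills_def)
  obtain x' i u where x: "x' \<noteq> 0" "is_unit v u" "x = x' ^ N * p ^ i * u"
    using decompose[OF N1] False by metis
  obtain y' j w where y: "y' \<noteq> 0" "is_unit v w" "y = y' ^ N * p ^ j * w"
    using decompose[OF N1] False by metis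
  have "ac v p m x = mcoset v p m u" "ac v p m y = mcoset v p m w"
    using ac_decomposed[of m] N x y m by auto
  then have "u - w \<in> I m" using g mcoset_eq_iff by metis
  then have "u - w \<in> I m'" using I_mono[OF m(2)] by blast
  moreover have "ac v p m' x = mcoset v p m' u" "ac v p m' y = mcoset v p m' w"
    using ac_decomposed[of m'] kills_mono[OF N m(2)] x y m by auto
  ultimately have "ac v p m' x = ac v p m' y" using mcoset_eq_iff by auto
  moreover have "v x - v y = natmul n' (natmul l g)" using g l by (simp add: natmul_mult)
  ultimately show ?thesis using False unfolding rho_eq_def by blast
qed


subsection \<open>Test points for a finite set of nonzero field elements\<close>

text \<open>Chosen such that passing from \<open>x\<close> to \<open>x'\<close> changes neither the class of an affine form
  \<open>a * x + c\<close> with \<open>c / a \<in> D\<close> nor, if \<open>D\<close> is closed under the relevant scalings, the relative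
  order of two such forms.\<close>

definition interchangeable :: "nat \<Rightarrow> nat \<Rightarrow> 'a set \<Rightarrow> 'a \<Rightarrow> 'a \<Rightarrow> bool" where
  "interchangeable n m D x x' \<longleftrightarrow>
     (\<exists>z\<in>I m. x' = x * (1 + z)) \<or>
     (x' \<noteq> 0 \<and> rho_eq v p n m x x' \<and>
       (\<forall>d\<in>D. (v d + natmul m (v p) \<le> v x \<and> v d + natmul m (v p) \<le> v x') \<or>
              (v x + natmul m (v p) \<le> v d \<and> v x' + natmul m (v p) \<le> v d)))"

lemma rho_inverse:
  assumes "1 \<le> m" "rho_eq v p n m x y"
  shows "rho_eq v p n m (inverse x) (inverse y)"
proof (cases "x = 0 \<or> y = 0")
  case True
  then show ?thesis using assms by (auto simp: rho_eq_def)
next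
  case False
  then show ?thesis
    using rho_scale[OF assms, of "inverse x * inverse y"] rho_sym by (simp add: field_simps)
qed

text \<open>The bounds on \<open>v c\<close> prepare the placement of points next to a scale: at
  least \<open>m\<close> steps away from it, yet inside any gap longer than \<open>m * n + n\<close>
  steps.\<close>

lemma finite_rho_representatives:
  assumes m: "1 \<le> m" and n: "1 \<le> n"
  shows "\<exists>C. finite C \<and> (\<forall>c\<in>C. c \<noteq> 0 \<and> natmul m (v p) \<le> v c \<and> v c \<le> natmul (m * n + n) (v p))
     \<and> (\<forall>x. x \<noteq> 0 \<longrightarrow> (\<exists>c\<in>C. rho_eq v p n m x c))"
proof -
  obtain F where F: "finite F" "\<And>x. x \<in> I 0 \<Longrightarrow> \<exists>f\<in>F. x - f \<in> I m"
    using finite_residues by meson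
  \<comment> \<open>Adding \<open>m * n\<close> to the exponent keeps the order modulo
    \<open>n\<close> and raises it to at least \<open>m\<close> steps.\<close>
  define C where "C = (\<lambda>(s, f). p ^ (m * n + s) * f) ` ({..<n} \<times> {f\<in>F. is_unit v f})"
  have "finite C" using F by (simp add: C_def)
  moreover have "c \<noteq> 0 \<and> natmul m (v p) \<le> v c \<and> v c \<le> natmul (m * n + n) (v p)"
    if c: "c \<in> C" for c
  proof -
    obtain s f where sf: "s < n" "is_unit v f" "c = p ^ (m * n + s) * f"
      using c by (auto simp: C_def)
    then have "v c = natmul (m * n + s) (v p)" "c \<noteq> 0" by (auto simp: is_unit_def v_mult v_power)
    moreover have "m \<le> m * n + s" using n by (simp add: trans_le_add1)
    ultimately show ?thesis using sf(1) natmul_v_p_mono by simp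
  qed
  moreover have "\<exists>c\<in>C. rho_eq v p n m x c" if x: "x \<noteq> 0" for x
  proof -
    obtain N where N: "kills N m" using ex_kills by blast
    then have N1: "1 \<le> N" by (simp add: kills_def)
    \<comment> \<open>With exponent \<open>N * n\<close> the order of the power of \<open>y\<close>
      is divisible by \<open>n\<close>, so the order of \<open>x\<close> modulo \<open>n\<close> can
      be read off from \<open>i\<close>.\<close>
    have kills: "kills (N * n) m"
      using N n unit_power[of _ n] unfolding kills_def by (auto simp: power_mult power_commutes)
        (metis mult.commute power_mult)
    have Nn: "1 \<le> N * n" using N1 n by simp
    obtain y i u where y: "y \<noteq> 0" "is_unit v u" "x = y ^ (N * n) * p ^ i * u"
      using decompose[OF Nn x] by metis
    obtain f where f: "f \<in> F" "u - f \<in> I m" using F y(2) unit_in_I0 by blast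
    have "f - u \<in> I m" using f(2) I_uminus[of "u - f"] by simp
    then have fu: "is_unit v f" using unit_add[OF y(2) _ m, of "f - u"] by simp
    define s where "s = i mod n"
    let ?c = "p ^ (m * n + s) * f"
    have "ac v p m x = mcoset v p m u" using ac_decomposed[OF m kills y(1,2)] y(3) by simp
    moreover have "ac v p m ?c = mcoset v p m f"
      using ac_decomposed[OF m kills, of 1 f "m * n + s"] fu by simp
    ultimately have "ac v p m x = ac v p m ?c" using f mcoset_eq_iff by simp
    moreover have "\<exists>g. v x - v ?c = natmul n g"
    proof -
      have "i = n * (i div n) + s" by (simp add: s_def)
      then have "natmul i (v p) = natmul n (natmul (i div n) (v p)) + natmul s (v p)"
        by (metis natmul_add_left natmul_mult)
      moreover have "v x = natmul (n * N) (v y) + natmul i (v p)"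
        using y by (simp add: v_mult v_power is_unit_def mult.commute)
      ultimately have "v x = natmul n (natmul N (v y) + natmul (i div n) (v p)) + natmul s (v p)"
        by (simp add: natmul_add natmul_mult add.assoc)
      moreover have "v ?c = natmul n (natmul m (v p)) + natmul s (v p)"
        using fu by (simp add: v_mult v_power is_unit_def natmul_add_left natmul_mult[symmetric] mult.commute)
      ultimately have "v x - v ?c = natmul n (natmul N (v y) + natmul (i div n) (v p) - natmul m (v p))"
        by (simp add: natmul_diff)
      then show ?thesis by blast
    qed
    ultimately have "rho_eq v p n m x ?c" using x fu by (auto simp: rho_eq_def is_unit_def)
    moreover have "?c \<in> C" using f fu n by (auto simp: C_def s_def)
    ultimately show ?thesis by blast
  qed
  ultimately show ?thesis by blast
qed

text \<open>Here representatives are taken up to a factor in 1 + pi^m R_K, so the order must match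
  exactly; in the given range it has only the standard values from \<open>-k\<close> to
  \<open>k\<close>, and units have finitely many classes modulo pi^m.\<close>

lemma finite_near_representatives:
  assumes m: "1 \<le> m"
  shows "\<exists>E. finite E \<and> (\<forall>x. x \<noteq> 0 \<longrightarrow> v x \<le> natmul k (v p) \<longrightarrow> - v x \<le> natmul k (v p)
     \<longrightarrow> (\<exists>e\<in>E. \<exists>z\<in>I m. e = x * (1 + z)))"
proof -
  obtain F where F: "finite F" "\<And>x. x \<in> I 0 \<Longrightarrow> \<exists>f\<in>F. x - f \<in> I m"
    using finite_residues by meson
  define P where "P = (\<lambda>s. p ^ s) ` {..k} \<union> (\<lambda>s. inverse (p ^ s)) ` {..k}"
  define E where "E = (\<lambda>(a, f). a * f) ` (P \<times> F)"
  have "finite E" using F by (simp add: E_def P_def)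
  moreover have "\<exists>e\<in>E. \<exists>z\<in>I m. e = x * (1 + z)"
    if x: "x \<noteq> 0" "v x \<le> natmul k (v p)" "- v x \<le> natmul k (v p)" for x
  proof -
    have k: "natmul k (v p) < natmul (Suc k) (v p)" using natmul_strict_mono[OF v_p_pos] by blast
    have "\<exists>a\<in>P. a \<noteq> 0 \<and> v a = v x"
    proof (cases "0 \<le> v x")
      case True
      then obtain i where "i < Suc k" "v x = natmul i (v p)"
        using v_eq_natmul[of "v x" "Suc k"] le_less_trans[OF x(2) k] by auto
      then show ?thesis by (intro bexI[of _ "p ^ i"]) (auto simp: P_def v_power)
    next
      case False
      then have "0 \<le> - v x" by simp
      then obtain i where "i < Suc k" "- v x = natmul i (v p)"
        using v_eq_natmul[OF _ le_less_trans[OF x(3) k]] by blast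
      then show ?thesis
        by (intro bexI[of _ "inverse (p ^ i)"]) (auto simp: P_def v_power v_inverse minus_equation_iff)
    qed
    then obtain a where a: "a \<in> P" "a \<noteq> 0" "v a = v x" by blast
    then have u: "is_unit v (x / a)" using x by (auto simp: is_unit_def v_divide)
    obtain f where f: "f \<in> F" "x / a - f \<in> I m" using F u unit_in_I0 by blast
    \<comment> \<open>Chosen so that \<open>f = (x / a) * (1 + ?z)\<close>, which places
      \<open>a * f\<close> next to \<open>x\<close>.\<close>
    let ?z = "(f - x / a) * inverse (x / a)"
    have "f - x / a \<in> I m" using f(2) I_uminus[of "x / a - f"] by simp
    then have "?z \<in> I m" using u by (intro I_absorb unit_in_I0 unit_inverse)
    moreover have "a * f = x * (1 + ?z)" using a x by (simp add: field_simps)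
    ultimately show ?thesis using a f by (force simp: E_def)
  qed
  ultimately show ?thesis by blast
qed

text \<open>\<open>W\<close> is quantified before \<open>D\<close> because the scales will be values
  of terms in the other variables. If \<open>x / d\<close> has order within the bound for some
  \<open>d\<close>, then \<open>E\<close> supplies the multiplier. Otherwise every gap exceeds the
  orders occurring in \<open>C\<close>: \<open>x\<close> is moved just above the largest order of a
  scale below it, by an element of \<open>C\<close>, or, if no scale lies below, just under the
  smallest order, by an inverse.\<close>

lemma finite_test_scales:
  assumes m: "1 \<le> m" and n: "1 \<le> n"
  shows "\<exists>W. finite W \<and> (\<forall>D x. finite D \<longrightarrow> D \<noteq> {} \<longrightarrow> 0 \<notin> D \<longrightarrow> x \<noteq> 0
    \<longrightarrow> (\<exists>d\<in>D. \<exists>w\<in>W. interchangeable n m D x (d * w)))"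
proof -
  let ?k = "m * n + n"
  let ?\<nu> = "natmul ?k (v p)" and ?\<mu> = "natmul m (v p)"
  obtain C where C: "finite C" "\<And>c. c \<in> C \<Longrightarrow> c \<noteq> 0 \<and> ?\<mu> \<le> v c \<and> v c \<le> ?\<nu>"
    "\<And>x. x \<noteq> 0 \<Longrightarrow> \<exists>c\<in>C. rho_eq v p n m x c"
    using finite_rho_representatives[OF m n] by meson
  obtain E where E: "finite E" "\<And>x. x \<noteq> 0 \<Longrightarrow> v x \<le> ?\<nu> \<Longrightarrow> - v x \<le> ?\<nu> \<Longrightarrow> \<exists>e\<in>E. \<exists>z\<in>I m. e = x * (1 + z)"
    using finite_near_representatives[OF m, of ?k] by meson
  have "m \<le> ?k" using n by (simp add: trans_le_add1)
  then have \<mu>: "?\<mu> \<le> ?\<nu>" by (rule natmul_v_p_mono)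
  have \<nu>: "0 \<le> ?\<nu>" using natmul_nonneg[OF less_imp_le[OF v_p_pos]] .
  have "\<exists>d\<in>D. \<exists>w\<in>E \<union> C \<union> inverse ` C. interchangeable n m D x (d * w)"
    if D: "finite D" "D \<noteq> {}" "0 \<notin> D" and x: "x \<noteq> 0" for D x
  proof (cases "\<exists>d\<in>D. v (x / d) \<le> ?\<nu> \<and> - v (x / d) \<le> ?\<nu>")
    case True
    then obtain d where d: "d \<in> D" "v (x / d) \<le> ?\<nu>" "- v (x / d) \<le> ?\<nu>" by blast
    then have d0: "d \<noteq> 0" using D by auto
    then obtain e z where "e \<in> E" "z \<in> I m" "e = x / d * (1 + z)"
      using E(2)[OF _ d(2,3)] x by auto
    moreover have "d * e = x * (1 + z)" using calculation d0 by simp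
    ultimately show ?thesis using d(1) unfolding interchangeable_def by blast
  next
    case False
    have far: "if v d < v x then v d + ?\<nu> < v x else v x + ?\<nu> < v d" if "d \<in> D" for d
    proof -
      have "d \<noteq> 0" using that D by auto
      then have "v (x / d) = v x - v d" using x by (simp add: v_divide)
      moreover have "?\<nu> < v (x / d) \<or> ?\<nu> < - v (x / d)" using False that not_le by blast
      ultimately have "?\<nu> < v x - v d \<or> ?\<nu> < v d - v x" by simp
      then have "v d + ?\<nu> < v x \<or> v x + ?\<nu> < v d" by (simp add: algebra_simps)
      moreover have "v d \<le> v d + ?\<nu>" "v x \<le> v x + ?\<nu>" using \<nu> by simp_all
      ultimately show ?thesis by (metis le_less_trans less_asym)
    qed
    show ?thesis
    proof (cases "\<exists>d\<in>D. v d < v x")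
      case True
      let ?D = "{d\<in>D. v d < v x}"
      have "Max (v ` ?D) \<in> v ` ?D" using D True by (intro Max_in) auto
      then obtain d where d: "d \<in> D" "v d < v x" "v d = Max (v ` ?D)" by auto
      have d_max: "v d' \<le> v d" if "d' \<in> D" "v d' < v x" for d'
        using that D unfolding d(3) by (intro Max_ge) auto
      have d0: "d \<noteq> 0" using d D by auto
      obtain c where c: "c \<in> C" "rho_eq v p n m (x / d) c" using C(3)[of "x / d"] x d0 by auto
      have c0: "c \<noteq> 0" "?\<mu> \<le> v c" "v c \<le> ?\<nu>" using C c by auto
      have vdc: "v (d * c) = v d + v c" using d0 c0 by (simp add: v_mult)
      have "rho_eq v p n m x (d * c)" using rho_scale[OF m c(2), of d] d0 by simp
      moreover have "(v d' + ?\<mu> \<le> v x \<and> v d' + ?\<mu> \<le> v (d * c)) \<or>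
              (v x + ?\<mu> \<le> v d' \<and> v (d * c) + ?\<mu> \<le> v d')" if d': "d' \<in> D" for d'
      proof (cases "v d' < v x")
        case True
        have "v d' + ?\<nu> < v x" using far[OF d'] True by simp
        then have "v d' + ?\<mu> \<le> v x" using \<mu> by (meson add_left_mono less_imp_le order_trans)
        moreover have "v d' + ?\<mu> \<le> v (d * c)" unfolding vdc
          using d_max[OF d' True] c0 by (intro add_mono)
        ultimately show ?thesis by blast
      next
        case False
        have "v x + ?\<nu> < v d'" using far[OF d'] False by simp
        then have 1: "v x + ?\<mu> \<le> v d'" using \<mu> by (meson add_left_mono less_imp_le order_trans)
        \<comment> \<open>The jump \<open>v c\<close> fits into the gap between \<open>d\<close> and
          \<open>x\<close>, so \<open>d * c\<close> does not overtake \<open>x\<close>, and scales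
          above \<open>x\<close> remain well above \<open>d * c\<close>.\<close>
        have "v d + ?\<nu> < v x" using far[OF d(1)] d(2) by simp
        then have "v (d * c) \<le> v x" unfolding vdc using c0
          by (meson add_left_mono less_imp_le order_trans)
        then show ?thesis using 1 by (meson add_right_mono order_trans)
      qed
      ultimately have "interchangeable n m D x (d * c)"
        using d0 c0 unfolding interchangeable_def by auto
      then show ?thesis using d(1) c(1) by blast
    next
      case none: False
      have "Min (v ` D) \<in> v ` D" using D by (intro Min_in) auto
      then obtain d where d: "d \<in> D" "v d = Min (v ` D)" by auto
      have d_min: "v d \<le> v d'" if "d' \<in> D" for d'
        using that D unfolding d(2) by (intro Min_le) auto
      have d0: "d \<noteq> 0" using d D by auto
      \<comment> \<open>The class of \<open>d / x\<close> is represented, not that of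
        \<open>x / d\<close>, so that \<open>inverse c\<close> lowers the order of \<open>d\<close>
        by at least \<open>m\<close> steps.\<close>
      obtain c where c: "c \<in> C" "rho_eq v p n m (d / x) c" using C(3)[of "d / x"] x d0 by auto
      have c0: "c \<noteq> 0" "?\<mu> \<le> v c" "v c \<le> ?\<nu>" using C c by auto
      have vdc: "v (d * inverse c) = v d - v c" using d0 c0 by (simp add: v_mult v_inverse)
      have "rho_eq v p n m x (d * inverse c)"
        using rho_scale[OF m rho_inverse[OF m c(2)], of d] d0 by simp
      moreover have "v x + ?\<mu> \<le> v d' \<and> v (d * inverse c) + ?\<mu> \<le> v d'" if d': "d' \<in> D" for d'
      proof
        have "v x + ?\<nu> < v d'" using far[OF d'] none d' by auto
        then show "v x + ?\<mu> \<le> v d'" using \<mu> by (meson add_left_mono less_imp_le order_trans)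
        have "v (d * inverse c) + ?\<mu> \<le> v d" unfolding vdc using c0 by (simp add: algebra_simps)
        then show "v (d * inverse c) + ?\<mu> \<le> v d'" using d_min[OF d'] by simp
      qed
      ultimately have "interchangeable n m D x (d * inverse c)"
        using d0 c0 unfolding interchangeable_def by auto
      then show ?thesis using d(1) c(1) by blast
    qed
  qed
  then show ?thesis using E C by (intro exI[of _ "E \<union> C \<union> inverse ` C"]) auto
qed

subsection \<open>Test points for finitely many affine forms in one variable\<close>

lemma v_near:
  assumes "1 \<le> m" "z \<in> I m" "x \<noteq> 0"
  shows "x * (1 + z) \<noteq> 0" "v (x * (1 + z)) = v x"
  using one_plus_I[OF assms(2,1)] assms(3) by (auto simp: v_mult)

lemma add_far:
  assumes m: "1 \<le> m" and "x \<noteq> 0" "y = 0 \<or> v x + natmul m (v p) \<le> v y"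
  shows "\<exists>z\<in>I m. x + y = x * (1 + z)"
proof (rule bexI)
  show "y / x \<in> I m"
    using assms by (cases "y = 0") (auto simp: I_def v_divide algebra_simps)
  show "x + y = x * (1 + y / x)" using assms by (simp add: field_simps)
qed

text \<open>Around a root, a form becomes \<open>c j + a j * x\<close>. The scale
  \<open>c j / a j\<close> decides which summand dominates, and \<open>c j / a k\<close> decides how
  a form dominated by \<open>c j\<close> compares with one dominated by \<open>a k * x\<close>. The
  scale 1 keeps the set of nonzero scales nonempty; the multiplier 0 provides the roots themselves,
  and the point 0 covers forms that are all constant in \<open>t\<close>.\<close>

lemma affine_test_points:
  fixes a b :: "'j \<Rightarrow> 'a"
  assumes m: "1 \<le> m" and J: "finite J"
    and W: "\<And>D x. finite D \<Longrightarrow> D \<noteq> {} \<Longrightarrow> 0 \<notin> D \<Longrightarrow> x \<noteq> 0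
      \<Longrightarrow> \<exists>d\<in>D. \<exists>w\<in>W. interchangeable n m D x (d * w)"
  defines "root i \<equiv> - b i / a i"
  defines "D i \<equiv> insert 1 {(a j * root i + b j) / a k | j k. j \<in> J \<and> k \<in> J \<and> a k \<noteq> 0}"
  defines "T \<equiv> insert 0 {root i + w * d | i d w. i \<in> J \<and> a i \<noteq> 0 \<and> d \<in> D i \<and> w \<in> insert 0 W}"
  shows "\<exists>t'\<in>T. (\<forall>j\<in>J. rho_eq v p n m (a j * t + b j) (a j * t' + b j)) \<and>
    (\<forall>j\<in>J. \<forall>k\<in>J. vdvd v (a j * t + b j) (a k * t + b k) \<longleftrightarrow> vdvd v (a j * t' + b j) (a k * t' + b k))"
proof -
  let ?A = "{i\<in>J. a i \<noteq> 0}"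
  consider (const) "?A = {}" | (root) i where "i \<in> ?A" "t = root i"
    | (generic) "?A \<noteq> {}" "\<And>i. i \<in> ?A \<Longrightarrow> t \<noteq> root i"
    by blast
  then show ?thesis
  proof cases
    case const
    then show ?thesis by (intro bexI[of _ 0]) (auto simp: T_def)
  next
    case (root i)
    then have "t \<in> T" unfolding T_def D_def by (intro insertI2 CollectI exI[of _ i] exI[of _ 1] exI[of _ 0]) auto
    then show ?thesis by (intro bexI[of _ t]) auto
  next
    case generic
    \<comment> \<open>The largest order of \<open>t - root i\<close> belongs to a root nearest to
      \<open>t\<close>.\<close>
    have "Max ((\<lambda>i. v (t - root i)) ` ?A) \<in> (\<lambda>i. v (t - root i)) ` ?A"
      using generic J by (intro Max_in) auto
    then obtain i where i: "i \<in> ?A" "v (t - root i) = Max ((\<lambda>i. v (t - root i)) ` ?A)" by auto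
    have i_max: "v (t - root j) \<le> v (t - root i)" if "j \<in> ?A" for j
      using that J unfolding i(2) by (intro Max_ge) auto
    define x where "x = t - root i"
    define c where "c j = a j * root i + b j" for j
    have x0: "x \<noteq> 0" using generic i by (auto simp: x_def)
    have form: "a j * (root i + y) + b j = c j + a j * y" for j y by (simp add: c_def algebra_simps)
    have t: "t = root i + x" by (simp add: x_def)
    \<comment> \<open>By the choice of \<open>i\<close>, \<open>t - root j\<close> has order at most
      that of \<open>x\<close>: adding \<open>c j\<close> to \<open>a j * x\<close> never raises the
      order by cancellation.\<close>
    have form_t: "c j + a j * x \<noteq> 0 \<and> v (c j + a j * x) \<le> v (a j * x)" if j: "j \<in> J" "a j \<noteq> 0" for j
    proof -
      have *: "c j + a j * x = a j * (t - root j)"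
        using j by (simp add: c_def x_def root_def field_simps)
      have nz: "t - root j \<noteq> 0" using generic(2) j by auto
      then show ?thesis using * i_max[of j] j x0 by (auto simp: v_mult x_def)
    qed
    have D: "finite (D i)" unfolding D_def
    proof -
      have "{(a j * root i + b j) / a k | j k. j \<in> J \<and> k \<in> J \<and> a k \<noteq> 0}
        \<subseteq> (\<lambda>(j, k). (a j * root i + b j) / a k) ` (J \<times> J)" by auto
      then show "finite (insert 1 {(a j * root i + b j) / a k | j k. j \<in> J \<and> k \<in> J \<and> a k \<noteq> 0})"
        using J finite_subset by blast
    qed
    let ?D = "D i - {0}"
    have "1 \<in> ?D" by (simp add: D_def)
    then obtain d w where dw: "d \<in> ?D" "w \<in> W" "interchangeable n m ?D x (d * w)"
      using W[of ?D x] D x0 by blast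
    define x' where "x' = d * w"
    define t' where "t' = root i + x'"
    have T: "t' \<in> T" unfolding T_def t'_def x'_def using dw i by (auto simp: mult.commute)
    have ic: "interchangeable n m ?D x x'" using dw by (simp add: x'_def)
    have key: "(\<forall>j\<in>J. rho_eq v p n m (c j + a j * x) (c j + a j * x')) \<and>
      (\<forall>j\<in>J. \<forall>k\<in>J. vdvd v (c j + a j * x) (c k + a k * x) \<longleftrightarrow> vdvd v (c j + a j * x') (c k + a k * x'))"
    proof (cases "\<exists>z\<in>I m. x' = x * (1 + z)")
      case True
      then obtain z where z: "z \<in> I m" "x' = x * (1 + z)" by blast
      \<comment> \<open>The form changes by \<open>a j * x * z\<close>, whose order is at least
        \<open>m\<close> steps above that of \<open>a j * x\<close>, hence by \<open>form_t\<close>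
        above that of the form itself.\<close>
      have near: "\<exists>w\<in>I m. c j + a j * x' = (c j + a j * x) * (1 + w)" if j: "j \<in> J" for j
      proof (cases "a j = 0")
        case True
        then show ?thesis by (intro bexI[of _ 0]) auto
      next
        case False
        have eq: "c j + a j * x' = (c j + a j * x) + a j * x * z" by (simp add: z algebra_simps)
        show ?thesis unfolding eq
        proof (rule add_far[OF m])
          show "c j + a j * x \<noteq> 0" using form_t[OF j False] by simp
          have "v (c j + a j * x) + natmul m (v p) \<le> v (a j * x) + v z" if "z \<noteq> 0"
            using form_t[OF j False] z that by (intro add_mono) (auto simp: I_def)
          then show "a j * x * z = 0 \<or> v (c j + a j * x) + natmul m (v p) \<le> v (a j * x * z)"
            using False x0 by (cases "z = 0") (auto simp: v_mult)
        qed
      qed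
      have eqv: "(c j + a j * x = 0 \<longleftrightarrow> c j + a j * x' = 0) \<and> v (c j + a j * x) = v (c j + a j * x')"
        if j: "j \<in> J" for j
        using near[OF j] v_near[OF m] by (metis mult_zero_left)
      show ?thesis
      proof (intro conjI ballI)
        show "rho_eq v p n m (c j + a j * x) (c j + a j * x')" if "j \<in> J" for j
          using near[OF that] rho_near[OF m] by metis
        show "vdvd v (c j + a j * x) (c k + a k * x) \<longleftrightarrow> vdvd v (c j + a j * x') (c k + a k * x')"
          if "j \<in> J" "k \<in> J" for j k
          using eqv that by (simp add: vdvd_def)
      qed
    next
      case False
      let ?\<mu> = "natmul m (v p)"
      have \<mu>: "0 < ?\<mu>" using m natmul_strict_mono[OF v_p_pos, of 0 m] by simp
      have x': "x' \<noteq> 0" "rho_eq v p n m x x'" and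
        sep: "\<And>d. d \<in> ?D \<Longrightarrow> (v d + ?\<mu> \<le> v x \<and> v d + ?\<mu> \<le> v x') \<or> (v x + ?\<mu> \<le> v d \<and> v x' + ?\<mu> \<le> v d)"
        using ic False unfolding interchangeable_def by blast+
      have sepc: "(v (c j) + ?\<mu> \<le> v (a k * x) \<and> v (c j) + ?\<mu> \<le> v (a k * x')) \<or>
          (v (a k * x) + ?\<mu> \<le> v (c j) \<and> v (a k * x') + ?\<mu> \<le> v (c j))"
        if jk: "j \<in> J" "k \<in> J" "a k \<noteq> 0" "c j \<noteq> 0" for j k
      proof -
        have "c j / a k \<in> ?D" using jk by (auto simp: D_def c_def)
        then show ?thesis using sep[of "c j / a k"] jk x0 x'(1)
          by (simp add: v_divide v_mult algebra_simps)
      qed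
      \<comment> \<open>In the small case the constant part dominates and the form keeps the class
        and order of \<open>c j\<close>; otherwise \<open>a j * x\<close> dominates and the class
        follows that of \<open>x\<close>. Separation from the scale \<open>c j / a j\<close> puts
        \<open>x\<close> and \<open>x'\<close> in the same case.\<close>
      define small where "small j \<longleftrightarrow> a j = 0 \<or> (c j \<noteq> 0 \<and> v (c j) + ?\<mu> \<le> v (a j * x))" for j
      have small: "(\<exists>z\<in>I m. c j + a j * x = c j * (1 + z)) \<and> (\<exists>z\<in>I m. c j + a j * x' = c j * (1 + z))"
        if j: "j \<in> J" "small j" for j
      proof (cases "a j = 0")
        case True
        then show ?thesis by (auto intro!: bexI[of _ 0])
      next
        case False
        then have cj: "c j \<noteq> 0" "v (c j) + ?\<mu> \<le> v (a j * x)" using j by (auto simp: small_def)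
        have "v (c j) + ?\<mu> \<le> v (a j * x')"
        proof (rule ccontr)
          assume "\<not> ?thesis"
          then have "v (a j * x) + ?\<mu> \<le> v (c j)" using sepc[OF j(1) j(1) False cj(1)] by blast
          then have "v (a j * x) + ?\<mu> + ?\<mu> \<le> v (a j * x)" using cj(2)
            by (meson add_right_mono order_trans)
          then show False using \<mu> by (simp add: add.assoc add_pos_pos not_le)
        qed
        then show ?thesis using cj by (intro conjI add_far[OF m]) auto
      qed
      have large: "(\<exists>z\<in>I m. c j + a j * x = a j * x * (1 + z)) \<and> (\<exists>z\<in>I m. c j + a j * x' = a j * x' * (1 + z))"
        if j: "j \<in> J" "\<not> small j" for j
      proof -
        have aj: "a j \<noteq> 0" "c j = 0 \<or> \<not> v (c j) + ?\<mu> \<le> v (a j * x)" using j by (auto simp: small_def)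
        have "c j = 0 \<or> v (a j * x) + ?\<mu> \<le> v (c j) \<and> v (a j * x') + ?\<mu> \<le> v (c j)"
          using sepc[OF j(1) j(1) aj(1)] aj(2) by blast
        then show ?thesis unfolding add.commute[of "c j"] using aj x0 x'(1)
          by (intro conjI add_far[OF m]) auto
      qed
      have vals: "if small j then (c j + a j * x = 0 \<longleftrightarrow> c j = 0) \<and> (c j + a j * x' = 0 \<longleftrightarrow> c j = 0) \<and>
          v (c j + a j * x) = v (c j) \<and> v (c j + a j * x') = v (c j)
        else c j + a j * x \<noteq> 0 \<and> c j + a j * x' \<noteq> 0 \<and> a j \<noteq> 0 \<and>
          v (c j + a j * x) = v (a j) + v x \<and> v (c j + a j * x') = v (a j) + v x'" if j: "j \<in> J" for j
      proof (cases "small j")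
        case True
        then show ?thesis using small[OF j True] v_near[OF m] by (metis mult_zero_left)
      next
        case False
        then have "a j \<noteq> 0" by (simp add: small_def)
        then show ?thesis using large[OF j False] v_near[OF m] False v_mult x0 x'(1)
          by (metis mult_eq_0_iff)
      qed
      show ?thesis
      proof (intro conjI ballI)
        fix j assume j: "j \<in> J"
        show "rho_eq v p n m (c j + a j * x) (c j + a j * x')"
        proof (cases "small j")
          case True
          then show ?thesis using small[OF j] rho_near[OF m] rho_sym rho_trans by metis
        next
          case False
          then show ?thesis using large[OF j] rho_near[OF m] rho_sym rho_trans rho_scale[OF m x'(2)]
            by metis
        qed
        fix k assume k: "k \<in> J"
        \<comment> \<open>Two forms of the small kind keep their orders, and two of the other kind
          are shifted by the same amount, so only mixed pairs are at stake. For these the gap at the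
          scale \<open>c j' / a k'\<close> makes the comparison strict and equal for
          \<open>x\<close> and \<open>x'\<close>.\<close>
        have order: "(v (c j') \<le> v (a k') + v x \<longleftrightarrow> v (c j') \<le> v (a k') + v x') \<and>
          (v (a k') + v x \<le> v (c j') \<longleftrightarrow> v (a k') + v x' \<le> v (c j'))"
          if "j' \<in> J" "k' \<in> J" "a k' \<noteq> 0" "c j' \<noteq> 0" for j' k'
        proof -
          have "v (c j') < v (a k') + v x \<and> v (c j') < v (a k') + v x' \<or>
            v (a k') + v x < v (c j') \<and> v (a k') + v x' < v (c j')"
            using sepc[OF that] \<mu> that(3) x0 x'(1)
            by (auto simp: v_mult) (meson less_add_same_cancel1 less_le_trans)+
          then show ?thesis by auto
        qed
        show "vdvd v (c j + a j * x) (c k + a k * x) \<longleftrightarrow> vdvd v (c j + a j * x') (c k + a k * x')"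
          using vals[OF j] vals[OF k] order[OF j k] order[OF k j]
          by (auto simp: vdvd_def split: if_splits)
      qed
    qed
    show ?thesis
      using T key unfolding t t'_def form[symmetric] by blast
  qed
qed

end

section \<open>Substitution in quantifier-free formulas\<close>

fun qfree :: "'a aform \<Rightarrow> bool" where
  "qfree (ANot f) = qfree f"
| "qfree (AAnd f g) = (qfree f \<and> qfree g)"
| "qfree (AEx i f) = False"
| "qfree _ = True"

fun tsubst :: "(nat \<Rightarrow> 'a aterm) \<Rightarrow> 'a aterm \<Rightarrow> 'a aterm" where
  "tsubst \<sigma> (AVar i) = \<sigma> i"
| "tsubst \<sigma> (AConst c) = AConst c"
| "tsubst \<sigma> (AAdd s t) = AAdd (tsubst \<sigma> s) (tsubst \<sigma> t)"
| "tsubst \<sigma> (ASub s t) = ASub (tsubst \<sigma> s) (tsubst \<sigma> t)"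
| "tsubst \<sigma> (ANeg t) = ANeg (tsubst \<sigma> t)"
| "tsubst \<sigma> (AScal c t) = AScal c (tsubst \<sigma> t)"

text \<open>No substitution takes place below quantifiers.\<close>

fun fsubst :: "(nat \<Rightarrow> 'a aterm) \<Rightarrow> 'a aform \<Rightarrow> 'a aform" where
  "fsubst \<sigma> (AEq s t) = AEq (tsubst \<sigma> s) (tsubst \<sigma> t)"
| "fsubst \<sigma> (ADiv s t) = ADiv (tsubst \<sigma> s) (tsubst \<sigma> t)"
| "fsubst \<sigma> (AR n m s t u) = AR n m (tsubst \<sigma> s) (tsubst \<sigma> t) (tsubst \<sigma> u)"
| "fsubst \<sigma> AFalse = AFalse"
| "fsubst \<sigma> (ANot f) = ANot (fsubst \<sigma> f)"
| "fsubst \<sigma> (AAnd f g) = AAnd (fsubst \<sigma> f) (fsubst \<sigma> g)"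
| "fsubst \<sigma> (AEx i f) = AEx i f"

lemma aeval_tsubst [simp]: "aeval e (tsubst \<sigma> t) = aeval (\<lambda>i. aeval e (\<sigma> i)) t"
  by (induction t) auto

lemma asat_fsubst: "qfree f \<Longrightarrow> asat v p e (fsubst \<sigma> f) = asat v p (\<lambda>i. aeval e (\<sigma> i)) f"
  by (induction f) auto

lemma asat_fsubst_single:
  assumes "qfree f"
  shows "asat v p e (fsubst (AVar(i := s)) f) = asat v p (e(i := aeval e s)) f"
proof -
  have "(\<lambda>j. aeval e ((AVar(i := s)) j)) = e(i := aeval e s)" by auto
  then show ?thesis using asat_fsubst[OF assms, of v p e "AVar(i := s)"] by simp
qed

lemma qfree_fsubst [simp]: "qfree f \<Longrightarrow> qfree (fsubst \<sigma> f)"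
  by (induction f) auto

lemma awf_fsubst [simp]: "awf f \<Longrightarrow> awf (fsubst \<sigma> f)"
  by (induction f) auto

lemma atvars_tsubst: "atvars (tsubst \<sigma> t) = (\<Union>i\<in>atvars t. atvars (\<sigma> i))"
  by (induction t) auto

lemma afv_fsubst: "qfree f \<Longrightarrow> afv (fsubst \<sigma> f) = (\<Union>i\<in>afv f. atvars (\<sigma> i))"
  by (induction f) (auto simp: atvars_tsubst)

lemma aeval_cong: "(\<And>i. i \<in> atvars t \<Longrightarrow> e i = e' i) \<Longrightarrow> aeval e t = aeval e' t"
  by (induction t) auto

lemma asat_cong: "(\<And>i. i \<in> afv f \<Longrightarrow> e i = e' i) \<Longrightarrow> asat v p e f = asat v p e' f"
proof (induction f arbitrary: e e')
  case (AEx i f)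
  have "asat v p (e(i := a)) f = asat v p (e'(i := a)) f" for a
    using AEx.prems by (intro AEx.IH) auto
  then show ?case by simp
next
  case (AEq s t)
  then show ?case using aeval_cong[of s e e'] aeval_cong[of t e e'] by auto
next
  case (ADiv s t)
  then show ?case using aeval_cong[of s e e'] aeval_cong[of t e e'] by auto
next
  case (AR n m s t u)
  then show ?case
    using aeval_cong[of s e e'] aeval_cong[of t e e'] aeval_cong[of u e e'] by auto
next
  case (AAnd f g)
  have "asat v p e f = asat v p e' f" "asat v p e g = asat v p e' g"
    using AAnd.prems by (auto intro!: AAnd.IH)
  then show ?case by simp
next
  case (ANot f)
  have "asat v p e f = asat v p e' f" using ANot.prems by (auto intro!: ANot.IH)
  then show ?case by simp
qed auto

definition AOr :: "'a aform \<Rightarrow> 'a aform \<Rightarrow> 'a aform" where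
  "AOr f g = ANot (AAnd (ANot f) (ANot g))"

lemma AOr_simps [simp]:
  "asat v p e (AOr f g) \<longleftrightarrow> asat v p e f \<or> asat v p e g"
  "afv (AOr f g) = afv f \<union> afv g"
  "awf (AOr f g) \<longleftrightarrow> awf f \<and> awf g"
  "qfree (AOr f g) \<longleftrightarrow> qfree f \<and> qfree g"
  by (auto simp: AOr_def)

definition ADisj :: "'a aform list \<Rightarrow> 'a aform" where
  "ADisj fs = foldr AOr fs AFalse"

lemma ADisj_simps [simp]:
  "asat v p e (ADisj fs) \<longleftrightarrow> (\<exists>f\<in>set fs. asat v p e f)"
  "afv (ADisj fs) = (\<Union>f\<in>set fs. afv f)"
  "awf (ADisj fs) \<longleftrightarrow> (\<forall>f\<in>set fs. awf f)"
  "qfree (ADisj fs) \<longleftrightarrow> (\<forall>f\<in>set fs. qfree f)"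
  by (induction fs; simp add: ADisj_def)+

definition AConj :: "'a aform list \<Rightarrow> 'a aform" where
  "AConj fs = foldr AAnd fs (ANot AFalse)"

lemma AConj_simps [simp]:
  "asat v p e (AConj fs) \<longleftrightarrow> (\<forall>f\<in>set fs. asat v p e f)"
  "afv (AConj fs) = (\<Union>f\<in>set fs. afv f)"
  "awf (AConj fs) \<longleftrightarrow> (\<forall>f\<in>set fs. awf f)"
  by (induction fs; simp add: AConj_def)+

section \<open>Elimination of a variable by test terms\<close>

fun coeff :: "nat \<Rightarrow> 'a::field aterm \<Rightarrow> 'a" where
  "coeff i (AVar j) = (if j = i then 1 else 0)"
| "coeff i (AConst c) = 0"
| "coeff i (AAdd s t) = coeff i s + coeff i t"
| "coeff i (ASub s t) = coeff i s - coeff i t"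
| "coeff i (ANeg t) = - coeff i t"
| "coeff i (AScal c t) = c * coeff i t"

definition rest :: "nat \<Rightarrow> 'a::field aterm \<Rightarrow> 'a aterm" where
  "rest i t = tsubst (AVar(i := AConst 0)) t"

lemma aeval_coeff_rest: "aeval (e(i := a)) t = coeff i t * a + aeval e (rest i t)"
  by (induction t) (auto simp: rest_def algebra_simps)

lemma atvars_rest: "atvars (rest i t) = atvars t - {i}"
  by (auto simp: rest_def atvars_tsubst split: if_splits)

text \<open>Classes and mutual divisibility of these terms decide a quantifier-free formula. An
  equation contributes a single difference, because \<open>rho_eq\<close> separates zero from
  nonzero.\<close>

fun forms :: "'a aform \<Rightarrow> 'a aterm set" where
  "forms (AEq s t) = {ASub s t}"
| "forms (ADiv s t) = {s, t}"
| "forms (AR n m s t u) = {ASub t s, u}"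
| "forms (ANot f) = forms f"
| "forms (AAnd f g) = forms f \<union> forms g"
| "forms _ = {}"

lemma finite_forms: "finite (forms f)"
  by (induction f) auto

lemma atvars_forms: "t \<in> forms f \<Longrightarrow> atvars t \<subseteq> afv f"
  by (induction f) auto

fun rel_bound :: "nat \<Rightarrow> nat \<Rightarrow> 'a aform \<Rightarrow> bool" where
  "rel_bound n m (AR n' m' s t u) \<longleftrightarrow> n' dvd n \<and> 1 \<le> m' \<and> m' \<le> m"
| "rel_bound n m (ANot f) \<longleftrightarrow> rel_bound n m f"
| "rel_bound n m (AAnd f g) \<longleftrightarrow> rel_bound n m f \<and> rel_bound n m g"
| "rel_bound n m (AEx i f) \<longleftrightarrow> rel_bound n m f"
| "rel_bound n m _ \<longleftrightarrow> True"

lemma rel_bound_mono: "rel_bound n m f \<Longrightarrow> n dvd n' \<Longrightarrow> m \<le> m' \<Longrightarrow> rel_bound n' m' f"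
  by (induction f) (auto intro: dvd_trans)

lemma ex_rel_bound: "awf f \<Longrightarrow> \<exists>n m. 1 \<le> n \<and> 1 \<le> m \<and> rel_bound n m f"
proof (induction f)
  case (AAnd f g)
  then obtain n m n' m' where "1 \<le> n" "1 \<le> m" "rel_bound n m f" "1 \<le> n'" "1 \<le> m'" "rel_bound n' m' g"
    by auto
  then show ?case
    using rel_bound_mono[of n m f "n * n'" "m + m'"] rel_bound_mono[of n' m' g "n * n'" "m + m'"]
    by (intro exI[of _ "n * n'"] exI[of _ "m + m'"]) auto
next
  case (AR n m s t u)
  then show ?case by (intro exI[of _ n] exI[of _ m]) auto
qed auto

context FqZ_valued_field
begin

lemma asat_same_type:
  assumes "qfree f" "rel_bound n m f"
    and "\<And>t. t \<in> forms f \<Longrightarrow> rho_eq v p n m (aeval e t) (aeval e' t)"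
    and "\<And>s t. s \<in> forms f \<Longrightarrow> t \<in> forms f \<Longrightarrow> vdvd v (aeval e s) (aeval e t) \<longleftrightarrow> vdvd v (aeval e' s) (aeval e' t)"
  shows "asat v p e f \<longleftrightarrow> asat v p e' f"
  using assms
proof (induction f)
  case (AEq s t)
  then show ?case using rho_zero_iff[of n m "aeval e (ASub s t)" "aeval e' (ASub s t)"] by auto
next
  case (AR n' m' s t u)
  then have "rho_eq v p n' m' (aeval e t - aeval e s) (aeval e' t - aeval e' s)"
    "rho_eq v p n' m' (aeval e u) (aeval e' u)"
    using AR.prems(3)[of "ASub t s"] AR.prems(3)[of u] rho_coarsen[of m' m n' n] by auto
  then show ?case using rho_sym rho_trans by (metis asat.simps(3))
qed auto

text \<open>\<open>T\<close> is built from \<open>f\<close> and \<open>i\<close> alone; for each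
  assignment the points of \<open>affine_test_points\<close> are then recognised as values of its
  terms. Matching the truth value of \<open>f\<close>, instead of only preserving its truth, follows
  at no cost since the whole type is matched.\<close>

lemma finite_test_terms:
  fixes f :: "'a aform"
  assumes f: "qfree f" "awf f"
  shows "\<exists>T. finite T \<and> (\<forall>s\<in>T. atvars s \<subseteq> afv f - {i}) \<and>
    (\<forall>e a. \<exists>s\<in>T. asat v p (e(i := a)) f \<longleftrightarrow> asat v p (e(i := aeval e s)) f)"
proof -
  obtain n m where nm: "1 \<le> n" "1 \<le> m" "rel_bound n m f" using ex_rel_bound[OF f(2)] by blast
  obtain W where W: "finite W" "\<And>D x. finite D \<Longrightarrow> D \<noteq> {} \<Longrightarrow> 0 \<notin> D \<Longrightarrow> x \<noteq> 0
    \<Longrightarrow> \<exists>d\<in>D. \<exists>w\<in>W. interchangeable n m D x (d * w)"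
    using finite_test_scales[OF nm(2,1)] by meson
  define L where "L = forms f"
  define root where "root t = AScal (- inverse (coeff i t)) (rest i t)" for t :: "'a aterm"
  define val where "val r s u = AScal (inverse (coeff i u)) (AAdd (AScal (coeff i s) (root r)) (rest i s))"
    for r s u :: "'a aterm"
  define T where "T = insert (AConst 0) ((\<lambda>(r, w, d). AAdd (root r) (AScal w d)) `
    (SIGMA r:L. insert 0 W \<times> insert (AConst 1) ((\<lambda>(s, u). val r s u) ` (L \<times> L))))"
  have L: "finite L" by (simp add: L_def finite_forms)
  have "finite T" using L W by (auto simp: T_def)
  moreover have "atvars s \<subseteq> afv f - {i}" if "s \<in> T" for s
    using that atvars_forms[of _ f] by (fastforce simp: T_def L_def root_def val_def atvars_rest)
  moreover have "\<exists>s\<in>T. asat v p (e(i := a)) f \<longleftrightarrow> asat v p (e(i := aeval e s)) f" for e a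
  proof -
    define b where "b t = aeval e (rest i t)" for t
    define rt where "rt t = - b t / coeff i t" for t
    define D where "D r = insert 1 {(coeff i s * rt r + b s) / coeff i u | s u. s \<in> L \<and> u \<in> L \<and> coeff i u \<noteq> 0}" for r
    have "\<exists>t'\<in>insert 0 {rt r + w * d | r d w. r \<in> L \<and> coeff i r \<noteq> 0 \<and> d \<in> D r \<and> w \<in> insert 0 W}.
       (\<forall>j\<in>L. rho_eq v p n m (coeff i j * a + b j) (coeff i j * t' + b j)) \<and>
      (\<forall>j\<in>L. \<forall>k\<in>L. vdvd v (coeff i j * a + b j) (coeff i k * a + b k)
        \<longleftrightarrow> vdvd v (coeff i j * t' + b j) (coeff i k * t' + b k))"
      unfolding rt_def D_def by (rule affine_test_points[OF nm(2) L W(2)])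
    then obtain t' where t': "t' = 0 \<or> (\<exists>r d w. t' = rt r + w * d \<and> r \<in> L \<and> d \<in> D r \<and> w \<in> insert 0 W)"
      and same: "\<And>j. j \<in> L \<Longrightarrow> rho_eq v p n m (coeff i j * a + b j) (coeff i j * t' + b j)"
      "\<And>j k. j \<in> L \<Longrightarrow> k \<in> L \<Longrightarrow> vdvd v (coeff i j * a + b j) (coeff i k * a + b k)
        \<longleftrightarrow> vdvd v (coeff i j * t' + b j) (coeff i k * t' + b k)"
      by blast
    have root: "aeval e (root r) = rt r" for r by (simp add: root_def rt_def b_def divide_inverse)
    have "\<exists>s\<in>T. aeval e s = t'"
      using t'
    proof
      assume "\<exists>r d w. t' = rt r + w * d \<and> r \<in> L \<and> d \<in> D r \<and> w \<in> insert 0 W"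
      then obtain r d w where rdw: "t' = rt r + w * d" "r \<in> L" "d \<in> D r" "w \<in> insert 0 W" by blast
      have "\<exists>d'\<in>insert (AConst 1) ((\<lambda>(s, u). val r s u) ` (L \<times> L)). aeval e d' = d"
      proof (cases "d = 1")
        case False
        then obtain s u where "s \<in> L" "u \<in> L" "d = (coeff i s * rt r + b s) / coeff i u"
          using rdw(3) by (auto simp: D_def)
        then show ?thesis
          by (intro bexI[of _ "val r s u"]) (auto simp: val_def root b_def divide_inverse mult.commute)
      qed auto
      then obtain d' where d': "d' \<in> insert (AConst 1) ((\<lambda>(s, u). val r s u) ` (L \<times> L))" "aeval e d' = d"
        by blast
      have "(\<lambda>(r, w, d). AAdd (root r) (AScal w d)) (r, w, d') \<in> T"
        unfolding T_def
        by (rule insertI2, rule imageI, rule SigmaI[OF rdw(2)], rule SigmaI[OF rdw(4) d'(1)])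
      then show ?thesis using rdw(1) d'(2) root by force
    qed (auto simp: T_def)
    then obtain s where s: "s \<in> T" "aeval e s = t'" by blast
    have "asat v p (e(i := a)) f \<longleftrightarrow> asat v p (e(i := t')) f"
      using f(1) nm(3)
    proof (rule asat_same_type)
      show "rho_eq v p n m (aeval (e(i := a)) t) (aeval (e(i := t')) t)" if "t \<in> forms f" for t
        using same(1)[of t] that by (simp add: aeval_coeff_rest b_def L_def)
      show "vdvd v (aeval (e(i := a)) s) (aeval (e(i := a)) t)
        \<longleftrightarrow> vdvd v (aeval (e(i := t')) s) (aeval (e(i := t')) t)" if "s \<in> forms f" "t \<in> forms f" for s t
        using same(2)[of s t] that by (simp add: aeval_coeff_rest b_def L_def)
    qed
    then show ?thesis using s by (intro bexI[of _ s]) simp_all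
  qed
  ultimately show ?thesis by blast
qed

theorem quantifier_elimination:
  assumes "awf f"
  shows "\<exists>g. qfree g \<and> awf g \<and> afv g \<subseteq> afv f \<and> (\<forall>e. asat v p e g \<longleftrightarrow> asat v p e f)"
  using assms
proof (induction f)
  case (ANot f)
  then obtain g where "qfree g" "awf g" "afv g \<subseteq> afv f" "\<And>e. asat v p e g \<longleftrightarrow> asat v p e f"
    by auto
  then show ?case by (intro exI[of _ "ANot g"]) auto
next
  case (AAnd f1 f2)
  then obtain g1 g2 where "qfree g1" "awf g1" "afv g1 \<subseteq> afv f1" "\<And>e. asat v p e g1 \<longleftrightarrow> asat v p e f1"
    "qfree g2" "awf g2" "afv g2 \<subseteq> afv f2" "\<And>e. asat v p e g2 \<longleftrightarrow> asat v p e f2"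
    by auto
  then show ?case by (intro exI[of _ "AAnd g1 g2"]) auto
next
  case (AEx i f)
  then obtain g where g: "qfree g" "awf g" "afv g \<subseteq> afv f" "\<And>e. asat v p e g \<longleftrightarrow> asat v p e f"
    by auto
  obtain T where T: "finite T" "\<And>s. s \<in> T \<Longrightarrow> atvars s \<subseteq> afv g - {i}"
    "\<And>e a. \<exists>s\<in>T. asat v p (e(i := a)) g \<longleftrightarrow> asat v p (e(i := aeval e s)) g"
    using finite_test_terms[OF g(1,2), of i] by meson
  obtain ts where ts: "set ts = T" using finite_list[OF T(1)] by blast
  \<comment> \<open>Each disjunct exhibits the value of \<open>s\<close> as a witness; conversely,
    the equivalence for \<open>T\<close> carries any witness to some test term.\<close>
  let ?h = "ADisj (map (\<lambda>s. fsubst (AVar(i := s)) g) ts)"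
  have "asat v p e ?h \<longleftrightarrow> asat v p e (AEx i f)" for e
    using T(3)[of e] by (simp add: ts asat_fsubst_single[OF g(1)] g(4)[symmetric]) metis
  moreover have "afv ?h \<subseteq> afv (AEx i f)"
    using T(2) g(1,3) by (fastforce simp: ts afv_fsubst split: if_splits)
  ultimately show ?case using g by (intro exI[of _ ?h]) auto
next
  case (AEq s t)
  show ?case by (intro exI[of _ "AEq s t"]) auto
next
  case (ADiv s t)
  show ?case by (intro exI[of _ "ADiv s t"]) auto
next
  case (AR n m s t u)
  then show ?case by (intro exI[of _ "AR n m s t u"]) auto
next
  case AFalse
  show ?case by (intro exI[of _ AFalse]) auto
qed

section \<open>Definable Skolem functions\<close>

text \<open>The last coordinate is eliminated first. Its test term may mention coordinates from
  \<open>k\<close> on, which the substitutions found for the shorter tuple replace by terms in the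
  first \<open>k\<close> variables. Fixing those \<open>k\<close> variables is what will make the
  resulting function a section of the projection.\<close>

lemma finite_skolem_substitutions:
  assumes "qfree f" "awf f" "afv f \<subseteq> {..<k + r}"
  shows "\<exists>\<Sigma>. finite \<Sigma> \<and> (\<forall>\<sigma>\<in>\<Sigma>. (\<forall>i<k. \<sigma> i = AVar i) \<and> (\<forall>i<k + r. atvars (\<sigma> i) \<subseteq> {..<k})) \<and>
    (\<forall>e. asat v p e f \<longrightarrow> (\<exists>\<sigma>\<in>\<Sigma>. asat v p e (fsubst \<sigma> f)))"
  using assms
proof (induction r arbitrary: f)
  case 0
  then have "asat v p e (fsubst AVar f) = asat v p e f" for e
    by (simp add: asat_fsubst)
  then show ?case by (intro exI[of _ "{AVar}"]) auto
next
  case (Suc r)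
  let ?i = "k + r"
  obtain T where T: "finite T" "\<And>s. s \<in> T \<Longrightarrow> atvars s \<subseteq> afv f - {?i}"
    "\<And>e a. \<exists>s\<in>T. asat v p (e(?i := a)) f \<longleftrightarrow> asat v p (e(?i := aeval e s)) f"
    using finite_test_terms[OF Suc.prems(1,2), of ?i] by meson
  have Tk: "atvars s \<subseteq> {..<k + r}" if "s \<in> T" for s
    using T(2)[OF that] Suc.prems(3) by (force simp: less_Suc_eq subset_iff)
  define g where "g s = fsubst (AVar(?i := s)) f" for s
  have g: "qfree (g s)" "awf (g s)" for s using Suc.prems by (auto simp: g_def)
  define Q where "Q s \<Sigma> \<longleftrightarrow> finite \<Sigma> \<and>
      (\<forall>\<sigma>\<in>\<Sigma>. (\<forall>i<k. \<sigma> i = AVar i) \<and> (\<forall>i<k + r. atvars (\<sigma> i) \<subseteq> {..<k})) \<and>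
      (\<forall>e. asat v p e (g s) \<longrightarrow> (\<exists>\<sigma>\<in>\<Sigma>. asat v p e (fsubst \<sigma> (g s))))" for s \<Sigma>
  have "\<exists>\<Sigma>. Q s \<Sigma>" if "s \<in> T" for s
  proof -
    have "afv (g s) \<subseteq> {..<k + r}"
      using Tk[OF that] Suc.prems by (fastforce simp: g_def afv_fsubst less_Suc_eq split: if_splits)
    then show ?thesis unfolding Q_def by (rule Suc.IH[OF g])
  qed
  then have "\<forall>s\<in>T. \<exists>\<Sigma>. Q s \<Sigma>" by blast
  from bchoice[OF this] obtain S where "\<forall>s\<in>T. Q s (S s)" by blast
  then have Q: "Q s (S s)" if "s \<in> T" for s using that by blast
  have S: "finite (S s)" "\<And>\<sigma> i. \<sigma> \<in> S s \<Longrightarrow> i < k \<Longrightarrow> \<sigma> i = AVar i"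
    "\<And>\<sigma> i. \<sigma> \<in> S s \<Longrightarrow> i < k + r \<Longrightarrow> atvars (\<sigma> i) \<subseteq> {..<k}"
    "\<And>e. asat v p e (g s) \<Longrightarrow> \<exists>\<sigma>\<in>S s. asat v p e (fsubst \<sigma> (g s))" if "s \<in> T" for s
    using Q[OF that] unfolding Q_def by blast+
  \<comment> \<open>The last variable becomes \<open>s\<close>, and \<open>\<sigma>\<close> is then
    applied to everything, including the variables of \<open>s\<close>.\<close>
  define comp where "comp s \<sigma> = (\<lambda>j. tsubst \<sigma> ((AVar(?i := s)) j))" for s and \<sigma> :: "nat \<Rightarrow> 'a aterm"
  define \<Sigma> where "\<Sigma> = (\<Union>s\<in>T. comp s ` S s)"
  have "finite \<Sigma>" unfolding \<Sigma>_def by (intro finite_UN_I finite_imageI T(1) S(1))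
  moreover have "(\<forall>i<k. \<tau> i = AVar i) \<and> (\<forall>i<k + Suc r. atvars (\<tau> i) \<subseteq> {..<k})" if "\<tau> \<in> \<Sigma>" for \<tau>
  proof -
    obtain s \<sigma> where s: "s \<in> T" "\<sigma> \<in> S s" "\<tau> = comp s \<sigma>" using \<open>\<tau> \<in> \<Sigma>\<close> by (auto simp: \<Sigma>_def)
    have "atvars (tsubst \<sigma> s) \<subseteq> {..<k}"
      using S(3)[OF s(1,2)] Tk[OF s(1)] unfolding atvars_tsubst by blast
    then show ?thesis using S(2,3)[OF s(1,2)] by (auto simp: s(3) comp_def less_Suc_eq)
  qed
  moreover have "\<exists>\<tau>\<in>\<Sigma>. asat v p e (fsubst \<tau> f)" if e: "asat v p e f" for e
  proof -
    \<comment> \<open>With \<open>a = e ?i\<close> the update on the left of the equivalence is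
      trivial, so truth of \<open>f\<close> at \<open>e\<close> itself is transferred.\<close>
    obtain s where s: "s \<in> T" "asat v p (e(?i := aeval e s)) f"
      using T(3)[where e = e and a = "e ?i"] e by auto
    then have "asat v p e (g s)" using Suc.prems(1) by (simp add: g_def asat_fsubst_single)
    then obtain \<sigma> where \<sigma>: "\<sigma> \<in> S s" "asat v p e (fsubst \<sigma> (g s))" using S(4) s(1) by blast
    then have "asat v p e (fsubst (comp s \<sigma>) f)"
      using Suc.prems(1) g(1) by (simp add: g_def asat_fsubst comp_def)
    then show ?thesis using s(1) \<sigma>(1) by (auto simp: \<Sigma>_def)
  qed
  ultimately show ?case by blast
qed

end

text \<open>The arguments of the function are the variables \<open>0, \<dots>, k - 1\<close> and its values the variables
  \<open>k, \<dots>, k + N - 1\<close>.\<close>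

fun skolem_graph :: "nat \<Rightarrow> nat \<Rightarrow> 'a aform \<Rightarrow> (nat \<Rightarrow> 'a aterm) list \<Rightarrow> 'a aform" where
  "skolem_graph k N f [] = AFalse"
| "skolem_graph k N f (\<sigma> # \<sigma>s) =
     AOr (AAnd (fsubst \<sigma> f) (AConj (map (\<lambda>i. AEq (AVar (k + i)) (\<sigma> i)) [0..<N])))
       (AAnd (ANot (fsubst \<sigma> f)) (skolem_graph k N f \<sigma>s))"

text \<open>First match in the list; the default \<open>AVar\<close> is reached only when no
  substitution works, that is, outside the domain of the Skolem function.\<close>

fun skolem_choice :: "((nat \<Rightarrow> 'a aterm) \<Rightarrow> bool) \<Rightarrow> (nat \<Rightarrow> 'a aterm) list \<Rightarrow> (nat \<Rightarrow> 'a aterm)" where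
  "skolem_choice P [] = AVar"
| "skolem_choice P (\<sigma> # \<sigma>s) = (if P \<sigma> then \<sigma> else skolem_choice P \<sigma>s)"

lemma skolem_choice: "\<exists>\<sigma>\<in>set \<sigma>s. P \<sigma> \<Longrightarrow> skolem_choice P \<sigma>s \<in> set \<sigma>s \<and> P (skolem_choice P \<sigma>s)"
  by (induction \<sigma>s) auto

text \<open>The negated guard in the recursion leaves to later substitutions only the arguments
  rejected by earlier ones, so the formula follows the first match and describes a single-valued
  graph.\<close>

lemma asat_skolem_graph:
  "asat v p e (skolem_graph k N f \<sigma>s) \<longleftrightarrow> (\<exists>\<sigma>\<in>set \<sigma>s. asat v p e (fsubst \<sigma> f)) \<and>
     (\<forall>i<N. e (k + i) = aeval e (skolem_choice (\<lambda>\<sigma>. asat v p e (fsubst \<sigma> f)) \<sigma>s i))"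
  by (induction \<sigma>s) auto

theorem mainTheorem11:
  fixes v :: "'a::field \<Rightarrow> 'g::linordered_ab_group_add"
    and q k r :: nat and p :: 'a and X :: "'a list set"
  assumes "FqZ_field q v"
    and "uniformizer v p"
    and "X \<subseteq> {xs. length xs = k + r}"
    and "aff_definable v p (k + r) X"
  shows "\<exists>g. aff_definable_fun v p k (k + r) (take k ` X) g
           \<and> (\<forall>y \<in> take k ` X. g y \<in> X \<and> take k (g y) = y)"
proof -
  interpret FqZ_valued_field v p q by unfold_locales (fact assms)+
  let ?N = "k + r"
  obtain \<phi> where \<phi>: "awf \<phi>" "afv \<phi> \<subseteq> {..<?N}" "X = {xs. length xs = ?N \<and> asat v p (\<lambda>i. xs ! i) \<phi>}"
    using assms(4) unfolding aff_definable_def by blast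
  obtain f where f: "qfree f" "awf f" "afv f \<subseteq> {..<?N}" "\<And>e. asat v p e f \<longleftrightarrow> asat v p e \<phi>"
    using quantifier_elimination[OF \<phi>(1)] \<phi>(2) by (metis order_trans)
  have X: "X = {xs. length xs = ?N \<and> asat v p (\<lambda>i. xs ! i) f}" using \<phi>(3) f(4) by simp
  obtain \<Sigma> where \<Sigma>: "finite \<Sigma>" "\<And>\<sigma> i. \<sigma> \<in> \<Sigma> \<Longrightarrow> i < k \<Longrightarrow> \<sigma> i = AVar i"
    "\<And>\<sigma> i. \<sigma> \<in> \<Sigma> \<Longrightarrow> i < ?N \<Longrightarrow> atvars (\<sigma> i) \<subseteq> {..<k}"
    "\<And>e. asat v p e f \<Longrightarrow> \<exists>\<sigma>\<in>\<Sigma>. asat v p e (fsubst \<sigma> f)"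
    using finite_skolem_substitutions[OF f(1-3)] by meson
  obtain \<sigma>s where \<sigma>s: "set \<sigma>s = \<Sigma>" using finite_list[OF \<Sigma>(1)] by blast
  define sat where "sat e \<sigma> = asat v p e (fsubst \<sigma> f)" for e \<sigma>
  have fv: "afv (fsubst \<sigma> f) \<subseteq> {..<k}" if "\<sigma> \<in> \<Sigma>" for \<sigma>
    using \<Sigma>(3)[OF that] f(1,3) by (fastforce simp: afv_fsubst)
  \<comment> \<open>For \<open>y\<close> of length \<open>k\<close> the entries \<open>y ! i\<close>
    with \<open>i \<ge> k\<close> are unspecified, but for substitutions in \<open>\<Sigma>\<close>
    only the first \<open>k\<close> variables are evaluated.\<close>
  define g where "g y = (let \<sigma> = skolem_choice (sat (\<lambda>i. y ! i)) \<sigma>s in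
    map (\<lambda>i. aeval (\<lambda>i. y ! i) (\<sigma> i)) [0..<?N])" for y
  have len_g: "length (g y) = ?N" for y by (simp add: g_def Let_def)
  have sat_cong: "sat e \<sigma> \<longleftrightarrow> sat e' \<sigma>" if "\<sigma> \<in> \<Sigma>" "\<And>i. i < k \<Longrightarrow> e i = e' i" for e e' \<sigma>
    unfolding sat_def using fv[OF that(1)] that(2) by (intro asat_cong) auto
  \<comment> \<open>The graph formula is evaluated at \<open>y @ x\<close> and \<open>g\<close> at
    \<open>y\<close>; both must select the same substitution.\<close>
  have choice_cong: "skolem_choice (sat e) \<sigma>s = skolem_choice (sat e') \<sigma>s"
    if "\<And>i. i < k \<Longrightarrow> e i = e' i" for e e'
  proof -
    have "set \<tau>s \<subseteq> \<Sigma> \<Longrightarrow> skolem_choice (sat e) \<tau>s = skolem_choice (sat e') \<tau>s" for \<tau>s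
      using sat_cong[OF _ that] by (induction \<tau>s) auto
    then show ?thesis using \<sigma>s by simp
  qed
  have dom: "y \<in> take k ` X \<longleftrightarrow> length y = k \<and> (\<exists>\<sigma>\<in>\<Sigma>. sat (\<lambda>i. y ! i) \<sigma>)"
    and sel: "(\<exists>\<sigma>\<in>\<Sigma>. sat (\<lambda>i. y ! i) \<sigma>) \<Longrightarrow> length y = k \<Longrightarrow> g y \<in> X \<and> take k (g y) = y" for y
  proof -
    show sel: "g y \<in> X \<and> take k (g y) = y" if y: "\<exists>\<sigma>\<in>\<Sigma>. sat (\<lambda>i. y ! i) \<sigma>" "length y = k" for y
    proof -
      define \<sigma> where "\<sigma> = skolem_choice (sat (\<lambda>i. y ! i)) \<sigma>s"
      have \<sigma>: "\<sigma> \<in> \<Sigma>" "sat (\<lambda>i. y ! i) \<sigma>"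
        using skolem_choice[of \<sigma>s "sat (\<lambda>i. y ! i)"] y \<sigma>s by (auto simp: \<sigma>_def)
      have gy: "g y ! i = aeval (\<lambda>i. y ! i) (\<sigma> i)" if "i < ?N" for i
        using that by (simp add: g_def Let_def \<sigma>_def del: upt_Suc)
      have "asat v p (\<lambda>i. aeval (\<lambda>i. y ! i) (\<sigma> i)) f"
        using \<sigma>(2) f(1) by (simp add: sat_def asat_fsubst)
      moreover have "asat v p (\<lambda>i. aeval (\<lambda>i. y ! i) (\<sigma> i)) f \<longleftrightarrow> asat v p (\<lambda>i. g y ! i) f"
        using gy f(3) by (intro asat_cong) auto
      moreover have "take k (g y) = y"
        using \<Sigma>(2)[OF \<sigma>(1)] y(2) gy len_g by (intro nth_equalityI) auto
      ultimately show ?thesis using len_g X by simp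
    qed
    show "y \<in> take k ` X \<longleftrightarrow> length y = k \<and> (\<exists>\<sigma>\<in>\<Sigma>. sat (\<lambda>i. y ! i) \<sigma>)"
    proof
      assume "y \<in> take k ` X"
      then obtain x where x: "x \<in> X" "y = take k x" by blast
      then obtain \<sigma> where "\<sigma> \<in> \<Sigma>" "sat (\<lambda>i. x ! i) \<sigma>" using \<Sigma>(4) X by (auto simp: sat_def)
      then show "length y = k \<and> (\<exists>\<sigma>\<in>\<Sigma>. sat (\<lambda>i. y ! i) \<sigma>)"
        using x X sat_cong[of \<sigma> "\<lambda>i. x ! i" "\<lambda>i. y ! i"] by auto
    next
      assume "length y = k \<and> (\<exists>\<sigma>\<in>\<Sigma>. sat (\<lambda>i. y ! i) \<sigma>)"
      then show "y \<in> take k ` X" using sel[of y] by (metis image_eqI)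
    qed
  qed
  let ?\<psi> = "skolem_graph k ?N f \<sigma>s"
  have "awf ?\<psi>" using f(2) by (induction \<sigma>s) auto
  moreover have "afv (skolem_graph k ?N f \<tau>s) \<subseteq> {..<k + ?N}" if "set \<tau>s \<subseteq> \<Sigma>" for \<tau>s
    using that
  proof (induction \<tau>s)
    case (Cons \<tau> \<tau>s)
    then show ?case using fv[of \<tau>] \<Sigma>(3)[of \<tau>] by fastforce
  qed auto
  then have "afv ?\<psi> \<subseteq> {..<k + ?N}" using \<sigma>s by simp
  moreover have "{y @ g y | y. y \<in> take k ` X} = {z. length z = k + ?N \<and> asat v p (\<lambda>i. z ! i) ?\<psi>}"
  proof -
    have graph: "asat v p (\<lambda>i. (y @ x) ! i) ?\<psi> \<longleftrightarrow> y \<in> take k ` X \<and> x = g y"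
      if yx: "length y = k" "length x = ?N" for x y
    proof -
      let ?e = "\<lambda>i. (y @ x) ! i" and ?e' = "\<lambda>i. y ! i"
      let ?\<sigma> = "skolem_choice (sat ?e') \<sigma>s"
      have e: "?e i = ?e' i" if "i < k" for i using that yx by (simp add: nth_append)
      have "asat v p ?e ?\<psi> \<longleftrightarrow> (\<exists>\<sigma>\<in>\<Sigma>. sat ?e' \<sigma>) \<and> (\<forall>i<?N. x ! i = aeval ?e (?\<sigma> i))"
        using choice_cong[of ?e ?e'] sat_cong[of _ ?e ?e'] e yx(1)
        by (auto simp: asat_skolem_graph \<sigma>s sat_def[symmetric] nth_append)
      moreover have "aeval ?e (?\<sigma> i) = g y ! i" if "\<exists>\<sigma>\<in>\<Sigma>. sat ?e' \<sigma>" "i < ?N" for i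
      proof -
        have "?\<sigma> \<in> \<Sigma>" using skolem_choice[of \<sigma>s "sat ?e'"] that(1) \<sigma>s by auto
        then have "aeval ?e (?\<sigma> i) = aeval ?e' (?\<sigma> i)"
          using \<Sigma>(3)[OF _ that(2)] e by (intro aeval_cong) blast
        then show ?thesis using that(2) by (simp add: g_def Let_def del: upt_Suc)
      qed
      moreover have "x = g y \<longleftrightarrow> (\<forall>i<?N. x ! i = g y ! i)"
        using yx(2) len_g[of y] by (auto simp: list_eq_iff_nth_eq)
      ultimately show ?thesis using dom[of y] yx(1) by (cases "\<exists>\<sigma>\<in>\<Sigma>. sat ?e' \<sigma>") simp_all
    qed
    show ?thesis
    proof (intro set_eqI iffI)
      fix z assume "z \<in> {y @ g y | y. y \<in> take k ` X}"
      then obtain y where y: "z = y @ g y" "y \<in> take k ` X" by blast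
      then have "length y = k" using dom by blast
      then show "z \<in> {z. length z = k + ?N \<and> asat v p (\<lambda>i. z ! i) ?\<psi>}"
        using graph[of y "g y"] y len_g by simp
    next
      fix z assume "z \<in> {z. length z = k + ?N \<and> asat v p (\<lambda>i. z ! i) ?\<psi>}"
      then have z: "length z = k + ?N" "asat v p (\<lambda>i. z ! i) ?\<psi>" by auto
      have "take k z \<in> take k ` X \<and> drop k z = g (take k z)"
        using graph[of "take k z" "drop k z"] z by simp
      then show "z \<in> {y @ g y | y. y \<in> take k ` X}" by (metis (mono_tags, lifting) CollectI append_take_drop_id)
    qed
  qed
  ultimately have "aff_definable_fun v p k ?N (take k ` X) g"
    unfolding aff_definable_fun_def aff_definable_def using len_g by blast
  then show ?thesis using dom sel by blast
qed

end
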